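(* Let $\Phi=(A;\{E_i\}_{i=0}^d;A^*;\{E^*_i\}_{i=0}^d)$ be a Leonard system on $V$, with $d\ge 3$ and with $\mathbb F$ algebraically closed. (1) If $\Phi$ has $q$-Racah type, with parameters $q,h,h^*,s,s^*,r_1,r_2$, then ${\mathcal Z}(\Phi)\ne0$ if and only if $s^*=r_1^2$ or $s^*=r_2^2$. (2) If $\Phi$ has $q$-Hahn type, with parameters $q,h,h^*,s^*,r$, then ${\mathcal Z}(\Phi)\ne0$ if and only if $s^*=r^2$. (3) If $\Phi$ has Racah type, with parameters $h,h^*,s,s^*,r_1,r_2$, then ${\mathcal Z}(\Phi)\ne0$ if and only if $s^*=2r_1$ or $s^*=2r_2$. (4) If $\Phi$ has Bannai/Ito type, with parameters $h,h^*,s,s^*,r_1,r_2$, then ${\mathcal Z}(\Phi)\ne0$ if and only if $s^*=-2r_1$ or $s^*=-2r_2$.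
   Context: Let $\mathbb F$ be an algebraically closed field and $V$ a vector space over $\mathbb F$ of dimension $d+1$ with $d\ge 3$. "Scalar" means element of $\mathbb F$; integers appearing in formulas are read in $\mathbb F$. A tridiagonal matrix is irreducible if all entries on its subdiagonal and superdiagonal are nonzero. A Leonard pair on $V$ is an ordered pair $A,A^*\in \mathrm{End}(V)$ such that (i) there is a basis of $V$ with respect to which $A$ is irreducible tridiagonal and $A^*$ is diagonal; (ii) there is a basis of $V$ with respect to which $A^*$ is irreducible tridiagonal and $A$ is diagonal. Then $A,A^*$ are multiplicity-free (diagonalizable with one-dimensional eigenspaces). The primitive idempotent of $A$ for an eigenvalue $\theta$ is the projection onto the $\theta$-eigenspace along the sum of the other eigenspaces. An ordering $\{\theta_i\}_{i=0}^d$ of the eigenvalues of $A$ (and the corresponding ordering $\{E_i\}_{i=0}^d$ of primitive idempotents) is standard if corresponding eigenvectors $v_0,\dots,v_d$, in this order, form a basis as in (ii). Standard orderings for $A^*$ are defined similarly using (i). A Leonard system on $V$ is a sequence $\Phi=(A;\{E_i\}_{i=0}^d;A^*;\{E^*_i\}_{i=0}^d)$ where $A,A^*$ is a Leonard pair on $V$ and $\{E_i\}$, $\{E^*_i\}$ are standard orderings of the primitive idempotents of $A$, $A^*$. Parameter array: $\theta_i$ (resp. $\theta^*_i$) is the eigenvalue of $A$ (resp. $A^*$) for $E_i$ (resp. $E^*_i$). For $0\ne u\in E^*_0V$ the vectors $u_i=(A-\theta_0I)\cdots(A-\theta_{i-1}I)u$ $(0\le i\le d)$ form a basis of $V$, and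 $A^*u_0=\theta^*_0u_0$, $A^*u_i=\theta^*_iu_i+\varphi_iu_{i-1}$ $(1\le i\le d)$ for nonzero scalars $\varphi_i$; $\{\varphi_i\}_{i=1}^d$ is the first split sequence of $\Phi$. The second split sequence $\{\phi_i\}_{i=1}^d$ is the first split sequence of the Leonard system $(A;\{E_{d-i}\}_{i=0}^d;A^*;\{E^*_i\}_{i=0}^d)$. Zero diagonal space: ${\mathcal Z}(\Phi)$ is the set of $X\in\mathrm{Span}\{I,A^*,A,AA^*\}$ such that $E^*_iXE^*_i=0$ for $0\le i\le d$. Types (formulas for $\theta_i,\theta^*_i$ hold for $0\le i\le d$, those for $\varphi_i,\phi_i$ for $1\le i\le d$; the "parameters" in the claim are scalars as in these definitions): $q$-Racah type: there exist nonzero scalars $q,h,h^*,s,s^*,r_1,r_2$ with $r_1r_2=ss^*q^{d+1}$; none of $q^i,r_1q^i,r_2q^i,s^*q^i/r_1,s^*q^i/r_2$ equal to $1$ for $1\le i\le d$; $sq^i\ne1$, $s^*q^i\ne1$ for $2\le i\le 2d$; $\theta_i=\theta_0+h(1-q^i)(1-sq^{i+1})q^{-i}$, $\theta^*_i=\theta^*_0+h^*(1-q^i)(1-s^*q^{i+1})q^{-i}$; $\varphi_i=hh^*q^{1-2i}(1-q^i)(1-q^{i-d-1})(1-r_1q^i)(1-r_2q^i)$, $\phi_i=hh^*q^{1-2i}(1-q^i)(1-q^{i-d-1})(r_1-s^*q^i)(r_2-s^*q^i)/s^*$. $q$-Hahn type: there exist nonzero scalars $q,h,h^*,s^*,r$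 with none of $q^i,rq^i,s^*q^i/r$ equal to $1$ for $1\le i\le d$; $s^*q^i\ne1$ for $2\le i\le 2d$; $\theta_i=\theta_0+h(1-q^i)q^{-i}$, $\theta^*_i=\theta^*_0+h^*(1-q^i)(1-s^*q^{i+1})q^{-i}$; $\varphi_i=hh^*q^{1-2i}(1-q^i)(1-q^{i-d-1})(1-rq^i)$, $\phi_i=-hh^*q^{1-i}(1-q^i)(1-q^{i-d-1})(r-s^*q^i)$. Racah type: there exist scalars $h,h^*,s,s^*,r_1,r_2$ with $h,h^*$ nonzero; $r_1+r_2=s+s^*+d+1$; $\mathrm{char}\,\mathbb F$ is $0$ or a prime greater than $d$; none of $r_1,r_2,s^*-r_1,s^*-r_2$ equal to $-i$ for $1\le i\le d$; $s\ne-i$, $s^*\ne-i$ for $2\le i\le 2d$; $\theta_i=\theta_0+hi(i+1+s)$, $\theta^*_i=\theta^*_0+h^*i(i+1+s^* )$; $\varphi_i=hh^*i(i-d-1)(i+r_1)(i+r_2)$, $\phi_i=hh^*i(i-d-1)(i+s^*-r_1)(i+s^*-r_2)$. Bannai/Ito type: there exist scalars $h,h^*,s,s^*,r_1,r_2$ with $h,h^*$ nonzero; $\mathrm{char}\,\mathbb F$ is $0$ or an odd prime greater than $d/2$; $r_1+r_2=-s-s^*+d+1$; neither of $r_1,-s^*-r_1$ equal to $-i$ for $1\le i\le d$ with $d-i$ even; neither of $r_2,-s^*-r_2$ equal to $-i$ for $1\le i\le d$ with $i$ odd; neither of $s,s^*$ equal to $2i$ for $1\le i\le d$; $\theta_i=\theta_0+h(s-1+(1-s+2i)(-1)^i)$,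 $\theta^*_i=\theta^*_0+h^*(s^*-1+(1-s^*+2i)(-1)^i)$; if $d$ is even: $\varphi_i=-4hh^*i(i+r_1)$ and $\phi_i=4hh^*i(i-s^*-r_1)$ for $i$ even, $\varphi_i=-4hh^*(i-d-1)(i+r_2)$ and $\phi_i=4hh^*(i-d-1)(i-s^*-r_2)$ for $i$ odd; if $d$ is odd: $\varphi_i=\phi_i=-4hh^*i(i-d-1)$ for $i$ even, $\varphi_i=-4hh^*(i+r_1)(i+r_2)$ and $\phi_i=-4hh^*(i-s^*-r_1)(i-s^*-r_2)$ for $i$ odd. *)

theory Defs
  imports
    "HOL-Computational_Algebra.Polynomial"
    "HOL-Computational_Algebra.Primes"
    "HOL-Library.Function_Algebras"
begin

section \<open>Leonard systems\<close>

text \<open>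
  Families indexed by \<open>0, \<dots>, d\<close> (or \<open>1, \<dots>, d\<close>) are functions on \<open>nat\<close>; only the values at
  these indices matter. Endomorphisms are functions \<open>'b \<Rightarrow> 'b\<close>, and their product is composition.
\<close>

definition irreducible_tridiagonal :: "nat \<Rightarrow> (nat \<Rightarrow> nat \<Rightarrow> 'a::zero) \<Rightarrow> bool" where
  "irreducible_tridiagonal d M \<longleftrightarrow>
     (\<forall>i\<le>d. \<forall>j\<le>d. (i > Suc j \<or> j > Suc i) \<longrightarrow> M i j = 0) \<and>
     (\<forall>i<d. M (Suc i) i \<noteq> 0 \<and> M i (Suc i) \<noteq> 0)"

definition diagonal_matrix :: "nat \<Rightarrow> (nat \<Rightarrow> nat \<Rightarrow> 'a::zero) \<Rightarrow> bool" where
  "diagonal_matrix d M \<longleftrightarrow> (\<forall>i\<le>d. \<forall>j\<le>d. i \<noteq> j \<longrightarrow> M i j = 0)"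

text \<open>
  A copy of \<^locale>\<open>vector_space\<close> without further assumptions: definitions made in \<^locale>\<open>vector_space\<close>
  itself would also be instantiated by the global interpretation for real vector spaces, whose
  abbreviations hide the general constants.
\<close>

locale leonard_theory = vector_space scale
  for scale :: "'a::field \<Rightarrow> 'b::ab_group_add \<Rightarrow> 'b" (infixr "*s" 75)
begin

definition is_basis :: "nat \<Rightarrow> (nat \<Rightarrow> 'b) \<Rightarrow> bool" where
  "is_basis d v \<longleftrightarrow> inj_on v {..d} \<and> independent (v ` {..d}) \<and> span (v ` {..d}) = UNIV"

text \<open>Column convention: the \<open>j\<close>-th column holds the coordinates of \<open>X (v j)\<close>.\<close>

definition matrix_wrt :: "nat \<Rightarrow> (nat \<Rightarrow> 'b) \<Rightarrow> ('b \<Rightarrow> 'b) \<Rightarrow> nat \<Rightarrow> nat \<Rightarrow> 'a" where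
  "matrix_wrt d v X i j = representation (v ` {..d}) (X (v j)) (v i)"

definition leonard_basis :: "nat \<Rightarrow> ('b \<Rightarrow> 'b) \<Rightarrow> ('b \<Rightarrow> 'b) \<Rightarrow> (nat \<Rightarrow> 'b) \<Rightarrow> bool" where
  "leonard_basis d X Y v \<longleftrightarrow>
     is_basis d v \<and>
     irreducible_tridiagonal d (matrix_wrt d v X) \<and>
     diagonal_matrix d (matrix_wrt d v Y)"

definition leonard_pair :: "nat \<Rightarrow> ('b \<Rightarrow> 'b) \<Rightarrow> ('b \<Rightarrow> 'b) \<Rightarrow> bool" where
  "leonard_pair d A As \<longleftrightarrow>
     Vector_Spaces.linear scale scale A \<and>
     Vector_Spaces.linear scale scale As \<and>
     (\<exists>v. leonard_basis d A As v) \<and>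
     (\<exists>v. leonard_basis d As A v)"

definition eigenspace :: "('b \<Rightarrow> 'b) \<Rightarrow> 'a \<Rightarrow> 'b set" where
  "eigenspace A t = {v. A v = t *s v}"

definition eigenvalues :: "('b \<Rightarrow> 'b) \<Rightarrow> 'a set" where
  "eigenvalues A = {t. \<exists>v\<in>eigenspace A t. v \<noteq> 0}"

text \<open>
  The first three conjuncts force \<open>U \<inter> W = {0}\<close>, so that the space is the direct sum of \<open>U\<close> and \<open>W\<close>.
\<close>

definition is_projection :: "('b \<Rightarrow> 'b) \<Rightarrow> 'b set \<Rightarrow> 'b set \<Rightarrow> bool" where
  "is_projection P U W \<longleftrightarrow>
     Vector_Spaces.linear scale scale P \<and>
     (\<forall>u\<in>U. P u = u) \<and>
     (\<forall>w\<in>W. P w = 0) \<and>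
     (\<forall>v. \<exists>u\<in>U. \<exists>w\<in>W. v = u + w)"

definition primitive_idempotent :: "('b \<Rightarrow> 'b) \<Rightarrow> 'a \<Rightarrow> ('b \<Rightarrow> 'b) \<Rightarrow> bool" where
  "primitive_idempotent A t P \<longleftrightarrow>
     t \<in> eigenvalues A \<and>
     is_projection P (eigenspace A t) (span (\<Union>s\<in>eigenvalues A - {t}. eigenspace A s))"

definition eigenvalue_sequence ::
    "nat \<Rightarrow> ('b \<Rightarrow> 'b) \<Rightarrow> (nat \<Rightarrow> 'b \<Rightarrow> 'b) \<Rightarrow> (nat \<Rightarrow> 'a) \<Rightarrow> bool" where
  "eigenvalue_sequence d A E th \<longleftrightarrow> (\<forall>i\<le>d. primitive_idempotent A (th i) (E i))"

definition standard_ordering ::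
    "nat \<Rightarrow> ('b \<Rightarrow> 'b) \<Rightarrow> ('b \<Rightarrow> 'b) \<Rightarrow> (nat \<Rightarrow> 'a) \<Rightarrow> bool" where
  "standard_ordering d A As th \<longleftrightarrow>
     bij_betw th {..d} (eigenvalues A) \<and>
     (\<exists>v. (\<forall>i\<le>d. v i \<in> eigenspace A (th i) \<and> v i \<noteq> 0) \<and> leonard_basis d As A v)"

definition standard_idempotents ::
    "nat \<Rightarrow> ('b \<Rightarrow> 'b) \<Rightarrow> ('b \<Rightarrow> 'b) \<Rightarrow> (nat \<Rightarrow> 'b \<Rightarrow> 'b) \<Rightarrow> bool" where
  "standard_idempotents d A As E \<longleftrightarrow>
     (\<exists>th. standard_ordering d A As th \<and> eigenvalue_sequence d A E th)"

definition leonard_system ::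
    "nat \<Rightarrow> ('b \<Rightarrow> 'b) \<Rightarrow> (nat \<Rightarrow> 'b \<Rightarrow> 'b) \<Rightarrow> ('b \<Rightarrow> 'b) \<Rightarrow> (nat \<Rightarrow> 'b \<Rightarrow> 'b) \<Rightarrow> bool" where
  "leonard_system d A E As Es \<longleftrightarrow>
     leonard_pair d A As \<and>
     standard_idempotents d A As E \<and>
     standard_idempotents d As A Es"


section \<open>The parameter array\<close>

text \<open>\<open>split_vector A th u i\<close> is \<open>(A - th 0 I) \<cdots> (A - th (i - 1) I) u\<close>.\<close>

definition split_vector :: "('b \<Rightarrow> 'b) \<Rightarrow> (nat \<Rightarrow> 'a) \<Rightarrow> 'b \<Rightarrow> nat \<Rightarrow> 'b" where
  "split_vector A th u i = foldr (\<lambda>h w. A w - th h *s w) [0..<i] u"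

definition first_split_sequence ::
    "nat \<Rightarrow> ('b \<Rightarrow> 'b) \<Rightarrow> (nat \<Rightarrow> 'b \<Rightarrow> 'b) \<Rightarrow> ('b \<Rightarrow> 'b) \<Rightarrow> (nat \<Rightarrow> 'b \<Rightarrow> 'b) \<Rightarrow>
     (nat \<Rightarrow> 'a) \<Rightarrow> bool" where
  "first_split_sequence d A E As Es vphi \<longleftrightarrow>
     (\<exists>th ths. eigenvalue_sequence d A E th \<and> eigenvalue_sequence d As Es ths \<and>
        (\<forall>i\<in>{1..d}. vphi i \<noteq> 0) \<and>
        (\<forall>u\<in>range (Es 0) - {0}.
           is_basis d (split_vector A th u) \<and>
           As (split_vector A th u 0) = ths 0 *s split_vector A th u 0 \<and>
           (\<forall>i\<in>{1..d}. As (split_vector A th u i) =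
              ths i *s split_vector A th u i + vphi i *s split_vector A th u (i - 1))))"

definition second_split_sequence ::
    "nat \<Rightarrow> ('b \<Rightarrow> 'b) \<Rightarrow> (nat \<Rightarrow> 'b \<Rightarrow> 'b) \<Rightarrow> ('b \<Rightarrow> 'b) \<Rightarrow> (nat \<Rightarrow> 'b \<Rightarrow> 'b) \<Rightarrow>
     (nat \<Rightarrow> 'a) \<Rightarrow> bool" where
  "second_split_sequence d A E As Es phi \<longleftrightarrow>
     first_split_sequence d A (\<lambda>i. E (d - i)) As Es phi"

definition parameter_array ::
    "nat \<Rightarrow> ('b \<Rightarrow> 'b) \<Rightarrow> (nat \<Rightarrow> 'b \<Rightarrow> 'b) \<Rightarrow> ('b \<Rightarrow> 'b) \<Rightarrow> (nat \<Rightarrow> 'b \<Rightarrow> 'b) \<Rightarrow>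
     (nat \<Rightarrow> 'a) \<Rightarrow> (nat \<Rightarrow> 'a) \<Rightarrow> (nat \<Rightarrow> 'a) \<Rightarrow> (nat \<Rightarrow> 'a) \<Rightarrow> bool" where
  "parameter_array d A E As Es th ths vphi phi \<longleftrightarrow>
     eigenvalue_sequence d A E th \<and>
     eigenvalue_sequence d As Es ths \<and>
     first_split_sequence d A E As Es vphi \<and>
     second_split_sequence d A E As Es phi"


section \<open>The zero diagonal space\<close>

text \<open>
  The span is taken in the space of functions \<open>'b \<Rightarrow> 'b\<close> with pointwise operations; the span of
  linear maps consists of linear maps, so this is the span in the endomorphism algebra.
\<close>

definition zero_diagonal_space ::
    "nat \<Rightarrow> ('b \<Rightarrow> 'b) \<Rightarrow> ('b \<Rightarrow> 'b) \<Rightarrow> (nat \<Rightarrow> 'b \<Rightarrow> 'b) \<Rightarrow> ('b \<Rightarrow> 'b) set" where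
  "zero_diagonal_space d A As Es =
     {X \<in> module.span (\<lambda>c X v. c *s X v) {id, As, A, A \<circ> As}. \<forall>i\<le>d. Es i \<circ> X \<circ> Es i = 0}"

end

text \<open>This justifies the use of \<^const>\<open>module.span\<close> above.\<close>

lemma (in vector_space) vector_space_pointwise:
  "vector_space (\<lambda>c (X :: 'b \<Rightarrow> 'b) v. c *s X v)"
  by unfold_locales (simp_all add: fun_eq_iff scale_right_distrib scale_left_distrib)


section \<open>Types of parameter arrays\<close>

definition q_racah_array ::
    "nat \<Rightarrow> (nat \<Rightarrow> 'a::field) \<Rightarrow> (nat \<Rightarrow> 'a) \<Rightarrow> (nat \<Rightarrow> 'a) \<Rightarrow> (nat \<Rightarrow> 'a) \<Rightarrow>
     'a \<Rightarrow> 'a \<Rightarrow> 'a \<Rightarrow> 'a \<Rightarrow> 'a \<Rightarrow> 'a \<Rightarrow> 'a \<Rightarrow> bool" where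
  "q_racah_array d th ths vphi phi q h hs s ss r1 r2 \<longleftrightarrow>
     q \<noteq> 0 \<and> h \<noteq> 0 \<and> hs \<noteq> 0 \<and> s \<noteq> 0 \<and> ss \<noteq> 0 \<and> r1 \<noteq> 0 \<and> r2 \<noteq> 0 \<and>
     r1 * r2 = s * ss * q ^ (d + 1) \<and>
     (\<forall>i\<in>{1..d}. q ^ i \<noteq> 1 \<and> r1 * q ^ i \<noteq> 1 \<and> r2 * q ^ i \<noteq> 1 \<and>
        ss * q ^ i / r1 \<noteq> 1 \<and> ss * q ^ i / r2 \<noteq> 1) \<and>
     (\<forall>i\<in>{2..2*d}. s * q ^ i \<noteq> 1 \<and> ss * q ^ i \<noteq> 1) \<and>
     (\<forall>i\<le>d. th i = th 0 + h * (1 - q ^ i) * (1 - s * q ^ (i + 1)) * q powi (- int i)) \<and>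
     (\<forall>i\<le>d. ths i = ths 0 + hs * (1 - q ^ i) * (1 - ss * q ^ (i + 1)) * q powi (- int i)) \<and>
     (\<forall>i\<in>{1..d}. vphi i = h * hs * q powi (1 - 2 * int i) * (1 - q ^ i) *
        (1 - q powi (int i - int d - 1)) * (1 - r1 * q ^ i) * (1 - r2 * q ^ i)) \<and>
     (\<forall>i\<in>{1..d}. phi i = h * hs * q powi (1 - 2 * int i) * (1 - q ^ i) *
        (1 - q powi (int i - int d - 1)) * (r1 - ss * q ^ i) * (r2 - ss * q ^ i) / ss)"

definition q_hahn_array ::
    "nat \<Rightarrow> (nat \<Rightarrow> 'a::field) \<Rightarrow> (nat \<Rightarrow> 'a) \<Rightarrow> (nat \<Rightarrow> 'a) \<Rightarrow> (nat \<Rightarrow> 'a) \<Rightarrow>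
     'a \<Rightarrow> 'a \<Rightarrow> 'a \<Rightarrow> 'a \<Rightarrow> 'a \<Rightarrow> bool" where
  "q_hahn_array d th ths vphi phi q h hs ss r \<longleftrightarrow>
     q \<noteq> 0 \<and> h \<noteq> 0 \<and> hs \<noteq> 0 \<and> ss \<noteq> 0 \<and> r \<noteq> 0 \<and>
     (\<forall>i\<in>{1..d}. q ^ i \<noteq> 1 \<and> r * q ^ i \<noteq> 1 \<and> ss * q ^ i / r \<noteq> 1) \<and>
     (\<forall>i\<in>{2..2*d}. ss * q ^ i \<noteq> 1) \<and>
     (\<forall>i\<le>d. th i = th 0 + h * (1 - q ^ i) * q powi (- int i)) \<and>
     (\<forall>i\<le>d. ths i = ths 0 + hs * (1 - q ^ i) * (1 - ss * q ^ (i + 1)) * q powi (- int i)) \<and>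
     (\<forall>i\<in>{1..d}. vphi i = h * hs * q powi (1 - 2 * int i) * (1 - q ^ i) *
        (1 - q powi (int i - int d - 1)) * (1 - r * q ^ i)) \<and>
     (\<forall>i\<in>{1..d}. phi i = - h * hs * q powi (1 - int i) * (1 - q ^ i) *
        (1 - q powi (int i - int d - 1)) * (r - ss * q ^ i))"

definition racah_array ::
    "nat \<Rightarrow> (nat \<Rightarrow> 'a::field) \<Rightarrow> (nat \<Rightarrow> 'a) \<Rightarrow> (nat \<Rightarrow> 'a) \<Rightarrow> (nat \<Rightarrow> 'a) \<Rightarrow>
     'a \<Rightarrow> 'a \<Rightarrow> 'a \<Rightarrow> 'a \<Rightarrow> 'a \<Rightarrow> 'a \<Rightarrow> bool" where
  "racah_array d th ths vphi phi h hs s ss r1 r2 \<longleftrightarrow>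
     h \<noteq> 0 \<and> hs \<noteq> 0 \<and>
     r1 + r2 = s + ss + of_nat d + 1 \<and>
     (CHAR('a) = 0 \<or> prime CHAR('a) \<and> CHAR('a) > d) \<and>
     (\<forall>i\<in>{1..d}. r1 \<noteq> - of_nat i \<and> r2 \<noteq> - of_nat i \<and>
        ss - r1 \<noteq> - of_nat i \<and> ss - r2 \<noteq> - of_nat i) \<and>
     (\<forall>i\<in>{2..2*d}. s \<noteq> - of_nat i \<and> ss \<noteq> - of_nat i) \<and>
     (\<forall>i\<le>d. th i = th 0 + h * of_nat i * (of_nat i + 1 + s)) \<and>
     (\<forall>i\<le>d. ths i = ths 0 + hs * of_nat i * (of_nat i + 1 + ss)) \<and>
     (\<forall>i\<in>{1..d}. vphi i =
        h * hs * of_nat i * (of_nat i - of_nat d - 1) * (of_nat i + r1) * (of_nat i + r2)) \<and>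
     (\<forall>i\<in>{1..d}. phi i =
        h * hs * of_nat i * (of_nat i - of_nat d - 1) *
        (of_nat i + ss - r1) * (of_nat i + ss - r2))"

text \<open>Below, \<open>2 * CHAR('a) > d\<close> renders the condition that the characteristic exceeds \<open>d / 2\<close>.\<close>

definition bannai_ito_array ::
    "nat \<Rightarrow> (nat \<Rightarrow> 'a::field) \<Rightarrow> (nat \<Rightarrow> 'a) \<Rightarrow> (nat \<Rightarrow> 'a) \<Rightarrow> (nat \<Rightarrow> 'a) \<Rightarrow>
     'a \<Rightarrow> 'a \<Rightarrow> 'a \<Rightarrow> 'a \<Rightarrow> 'a \<Rightarrow> 'a \<Rightarrow> bool" where
  "bannai_ito_array d th ths vphi phi h hs s ss r1 r2 \<longleftrightarrow>
     h \<noteq> 0 \<and> hs \<noteq> 0 \<and>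
     (CHAR('a) = 0 \<or> prime CHAR('a) \<and> odd CHAR('a) \<and> 2 * CHAR('a) > d) \<and>
     r1 + r2 = - s - ss + of_nat d + 1 \<and>
     (\<forall>i\<in>{1..d}. even (d - i) \<longrightarrow> r1 \<noteq> - of_nat i \<and> - ss - r1 \<noteq> - of_nat i) \<and>
     (\<forall>i\<in>{1..d}. odd i \<longrightarrow> r2 \<noteq> - of_nat i \<and> - ss - r2 \<noteq> - of_nat i) \<and>
     (\<forall>i\<in>{1..d}. s \<noteq> 2 * of_nat i \<and> ss \<noteq> 2 * of_nat i) \<and>
     (\<forall>i\<le>d. th i = th 0 + h * (s - 1 + (1 - s + 2 * of_nat i) * (- 1) ^ i)) \<and>
     (\<forall>i\<le>d. ths i = ths 0 + hs * (ss - 1 + (1 - ss + 2 * of_nat i) * (- 1) ^ i)) \<and>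
     (even d \<longrightarrow>
        (\<forall>i\<in>{1..d}. even i \<longrightarrow>
           vphi i = - 4 * h * hs * of_nat i * (of_nat i + r1) \<and>
           phi i = 4 * h * hs * of_nat i * (of_nat i - ss - r1)) \<and>
        (\<forall>i\<in>{1..d}. odd i \<longrightarrow>
           vphi i = - 4 * h * hs * (of_nat i - of_nat d - 1) * (of_nat i + r2) \<and>
           phi i = 4 * h * hs * (of_nat i - of_nat d - 1) * (of_nat i - ss - r2))) \<and>
     (odd d \<longrightarrow>
        (\<forall>i\<in>{1..d}. even i \<longrightarrow>
           vphi i = - 4 * h * hs * of_nat i * (of_nat i - of_nat d - 1) \<and>
           phi i = - 4 * h * hs * of_nat i * (of_nat i - of_nat d - 1)) \<and>
        (\<forall>i\<in>{1..d}. odd i \<longrightarrow>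
           vphi i = - 4 * h * hs * (of_nat i + r1) * (of_nat i + r2) \<and>
           phi i = - 4 * h * hs * (of_nat i - ss - r1) * (of_nat i - ss - r2)))"

context leonard_theory
begin

definition q_racah_type ::
    "nat \<Rightarrow> ('b \<Rightarrow> 'b) \<Rightarrow> (nat \<Rightarrow> 'b \<Rightarrow> 'b) \<Rightarrow> ('b \<Rightarrow> 'b) \<Rightarrow> (nat \<Rightarrow> 'b \<Rightarrow> 'b) \<Rightarrow>
     'a \<Rightarrow> 'a \<Rightarrow> 'a \<Rightarrow> 'a \<Rightarrow> 'a \<Rightarrow> 'a \<Rightarrow> 'a \<Rightarrow> bool" where
  "q_racah_type d A E As Es q h hs s ss r1 r2 \<longleftrightarrow>
     (\<exists>th ths vphi phi. parameter_array d A E As Es th ths vphi phi \<and>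
        q_racah_array d th ths vphi phi q h hs s ss r1 r2)"

definition q_hahn_type ::
    "nat \<Rightarrow> ('b \<Rightarrow> 'b) \<Rightarrow> (nat \<Rightarrow> 'b \<Rightarrow> 'b) \<Rightarrow> ('b \<Rightarrow> 'b) \<Rightarrow> (nat \<Rightarrow> 'b \<Rightarrow> 'b) \<Rightarrow>
     'a \<Rightarrow> 'a \<Rightarrow> 'a \<Rightarrow> 'a \<Rightarrow> 'a \<Rightarrow> bool" where
  "q_hahn_type d A E As Es q h hs ss r \<longleftrightarrow>
     (\<exists>th ths vphi phi. parameter_array d A E As Es th ths vphi phi \<and>
        q_hahn_array d th ths vphi phi q h hs ss r)"

definition racah_type ::
    "nat \<Rightarrow> ('b \<Rightarrow> 'b) \<Rightarrow> (nat \<Rightarrow> 'b \<Rightarrow> 'b) \<Rightarrow> ('b \<Rightarrow> 'b) \<Rightarrow> (nat \<Rightarrow> 'b \<Rightarrow> 'b) \<Rightarrow>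
     'a \<Rightarrow> 'a \<Rightarrow> 'a \<Rightarrow> 'a \<Rightarrow> 'a \<Rightarrow> 'a \<Rightarrow> bool" where
  "racah_type d A E As Es h hs s ss r1 r2 \<longleftrightarrow>
     (\<exists>th ths vphi phi. parameter_array d A E As Es th ths vphi phi \<and>
        racah_array d th ths vphi phi h hs s ss r1 r2)"

definition bannai_ito_type ::
    "nat \<Rightarrow> ('b \<Rightarrow> 'b) \<Rightarrow> (nat \<Rightarrow> 'b \<Rightarrow> 'b) \<Rightarrow> ('b \<Rightarrow> 'b) \<Rightarrow> (nat \<Rightarrow> 'b \<Rightarrow> 'b) \<Rightarrow>
     'a \<Rightarrow> 'a \<Rightarrow> 'a \<Rightarrow> 'a \<Rightarrow> 'a \<Rightarrow> 'a \<Rightarrow> bool" where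
  "bannai_ito_type d A E As Es h hs s ss r1 r2 \<longleftrightarrow>
     (\<exists>th ths vphi phi. parameter_array d A E As Es th ths vphi phi \<and>
        bannai_ito_array d th ths vphi phi h hs s ss r1 r2)"

end

end

theory Submission
  imports Defs
begin

text \<open>
  In an eigenbasis of \<open>As\<close>, the element \<open>e0 I + e1 As + e2 A + e3 A As\<close> has diagonal entries
  \<open>e0 + e1 x i + e2 a i + e3 a i x i\<close>, where \<open>x i\<close> are the eigenvalues of \<open>As\<close> and \<open>a i\<close> is the diagonal of
  \<open>A\<close>. Comparing with the split basis gives \<open>a i = th i + c i - c (i + 1)\<close> with
  \<open>c i = vphi i / (x i - x (i - 1))\<close> and \<open>c 0 = c (d + 1) = 0\<close>. In each type the polynomial part of \<open>c\<close>
  combines with \<open>th i\<close> to an affine function of \<open>x i\<close>, so \<open>a i\<close> is a rational function of \<open>x i\<close> with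
  denominator of degree two. A linear dependence is then a cubic in \<open>x i\<close> with \<open>d + 1 \<ge> 4\<close> zeros, hence
  vanishes identically, and this makes a resultant vanish. Besides the factors of the claim, that
  resultant has factors whose vanishing means that \<open>x 0\<close> or \<open>x d\<close> is a pole of the rational function;
  there it does not give \<open>a 0\<close> or \<open>a d\<close>, and the corresponding row of the dependence has to be
  examined separately.
\<close>

section \<open>Diagonal entries of a Leonard system\<close>

definition diag_dependent :: "nat \<Rightarrow> (nat \<Rightarrow> 'a::field) \<Rightarrow> (nat \<Rightarrow> 'a) \<Rightarrow> bool" where
  "diag_dependent d x a \<longleftrightarrow>
     (\<exists>e0 e1 e2 e3. (e0, e1, e2, e3) \<noteq> (0, 0, 0, 0) \<and>
        (\<forall>i\<le>d. e0 + e1 * x i + e2 * a i + e3 * a i * x i = 0))"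

text \<open>The default 0 outside \<open>{1..d}\<close> stands for the missing \<open>vphi 0\<close>
  and \<open>vphi (d + 1)\<close>, so that the end entries \<open>a 0\<close> and \<open>a d\<close>
  obey the same formula as the inner ones.\<close>

definition split_ratio :: "nat \<Rightarrow> (nat \<Rightarrow> 'a::field) \<Rightarrow> (nat \<Rightarrow> 'a) \<Rightarrow> nat \<Rightarrow> 'a" where
  "split_ratio d ths vphi i = (if i \<in> {1..d} then vphi i / (ths i - ths (i - 1)) else 0)"

context leonard_theory
begin

section \<open>Coordinates in an indexed basis\<close>

abbreviation coord :: "nat \<Rightarrow> (nat \<Rightarrow> 'b) \<Rightarrow> nat \<Rightarrow> 'b \<Rightarrow> 'a" where
  "coord d v i w \<equiv> representation (v ` {..d}) w (v i)"

lemma linear_iff: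
  "Vector_Spaces.linear scale scale f \<longleftrightarrow>
     (\<forall>x y. f (x + y) = f x + f y) \<and> (\<forall>c x. f (c *s x) = c *s f x)"
  by (simp add: Vector_Spaces.linear_iff vector_space_axioms)

context
  fixes d v
  assumes basis: "is_basis d v"
begin

lemma basis_independent: "independent (v ` {..d})"
  and basis_span: "w \<in> span (v ` {..d})"
  and basis_inj: "inj_on v {..d}"
  using basis by (auto simp: is_basis_def)

lemma coord_add: "coord d v i (x + y) = coord d v i x + coord d v i y"
  by (simp add: representation_add[OF basis_independent basis_span basis_span])

lemma coord_diff: "coord d v i (x - y) = coord d v i x - coord d v i y"
  by (simp add: representation_diff[OF basis_independent basis_span basis_span])

lemma coord_scale: "coord d v i (c *s x) = c * coord d v i x"
  by (simp add: representation_scale[OF basis_independent basis_span])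

lemma coord_zero: "coord d v i 0 = 0"
  by (simp add: representation_zero)

lemma coord_sum: "coord d v i (sum f I) = (\<Sum>k\<in>I. coord d v i (f k))"
  by (induction I rule: infinite_finite_induct) (simp_all add: coord_add coord_zero)

lemma coord_basis: "i \<le> d \<Longrightarrow> j \<le> d \<Longrightarrow> coord d v i (v j) = (if i = j then 1 else 0)"
  using basis_inj by (auto simp: representation_basis[OF basis_independent] inj_on_eq_iff)

lemma coord_expand: "w = (\<Sum>i\<le>d. coord d v i w *s v i)"
proof -
  have "w = (\<Sum>b\<in>v ` {..d}. representation (v ` {..d}) w b *s b)"
    by (rule sum_representation_eq[symmetric, OF basis_independent basis_span]) auto
  also have "\<dots> = (\<Sum>i\<le>d. coord d v i w *s v i)"
    by (subst sum.reindex[OF basis_inj]) simp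
  finally show ?thesis .
qed

lemma coord_eqI: "(\<And>i. i \<le> d \<Longrightarrow> coord d v i x = coord d v i y) \<Longrightarrow> x = y"
  using coord_expand[of x] coord_expand[of y] by simp

lemma coord_linear:
  assumes "Vector_Spaces.linear scale scale f"
  shows "coord d v i (f w) = (\<Sum>k\<le>d. coord d v k w * coord d v i (f (v k)))"
proof -
  interpret f: Vector_Spaces.linear scale scale f by fact
  have "f w = (\<Sum>k\<le>d. coord d v k w *s f (v k))"
    by (subst coord_expand[of w]) (simp add: f.sum f.scale)
  then show ?thesis by (simp add: coord_sum coord_scale)
qed

lemma linear_eq_on_basis:
  assumes "Vector_Spaces.linear scale scale f" "Vector_Spaces.linear scale scale g"
    and "\<And>i. i \<le> d \<Longrightarrow> f (v i) = g (v i)"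
  shows "f w = g w"
  by (rule coord_eqI) (subst coord_linear[OF assms(1)], subst coord_linear[OF assms(2)], simp add: assms(3))

end

text \<open>An eigenvector for \<open>t\<close> is fixed by \<open>P\<close>, while \<open>P\<close>
  maps the whole space into the eigenspace for \<open>t'\<close>; a nonzero vector with both
  eigenvalues forces \<open>t = t'\<close>. This identifies the eigenvalue sequences that the
  definitions bind by separate existential quantifiers.\<close>

lemma primitive_idempotent_unique:
  assumes "primitive_idempotent A t P" "primitive_idempotent A t' P"
  shows "t = t'"
proof -
  obtain v where v: "v \<in> eigenspace A t" "v \<noteq> 0" "P v = v"
    using assms(1) by (auto simp: primitive_idempotent_def eigenvalues_def is_projection_def)
  let ?W = "span (\<Union>s\<in>eigenvalues A - {t'}. eigenspace A s)"
  have P: "is_projection P (eigenspace A t') ?W"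
    using assms(2) by (simp add: primitive_idempotent_def)
  then obtain u w where uw: "u \<in> eigenspace A t'" "w \<in> ?W" "v = u + w"
    by (auto simp: is_projection_def) metis
  have "P v = P u + P w" using P uw by (simp add: is_projection_def linear_iff)
  also have "\<dots> = u" using P uw by (simp add: is_projection_def)
  finally have "v = u" using v by simp
  then have "t *s v = t' *s v" using v uw by (simp add: eigenspace_def)
  then show ?thesis using v by (simp add: scale_right_imp_eq)
qed

lemma eigenvalue_sequence_unique:
  "eigenvalue_sequence d A E th \<Longrightarrow> eigenvalue_sequence d A E th' \<Longrightarrow> i \<le> d \<Longrightarrow> th i = th' i"
  unfolding eigenvalue_sequence_def by (blast intro: primitive_idempotent_unique)

section \<open>Split vectors and the diagonal of \<open>A\<close>\<close>

lemma split_vector_0: "split_vector A th u 0 = u"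
  by (simp add: split_vector_def)

text \<open>The definition applies the factors in the order \<open>i - 1, \<dots>, 0\<close>; this works since they commute.\<close>

lemma split_vector_Suc:
  assumes "Vector_Spaces.linear scale scale A"
  shows "split_vector A th u (Suc i) = A (split_vector A th u i) - th i *s split_vector A th u i"
proof -
  interpret A: Vector_Spaces.linear scale scale A by fact
  let ?f = "\<lambda>(h::nat) w. A w - th h *s w"
  have comm: "?f h (?f k w) = ?f k (?f h w)" for h k w
    by (simp add: A.diff A.scale scale_right_diff_distrib mult.commute algebra_simps)
  have "foldr ?f xs (?f k w) = ?f k (foldr ?f xs w)" for xs k w
  proof (induction xs)
    case (Cons h xs)
    then show ?case by (simp only: foldr.simps o_def comm[where h = h and k = k])
  qed simp
  from this[where xs = "[0..<i]" and k = i and w = u] show ?thesis by (simp add: split_vector_def)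
qed

lemma coord_eigenbasis:
  assumes w: "is_basis d w" and A: "Vector_Spaces.linear scale scale A"
    and eig: "\<And>k. k \<le> d \<Longrightarrow> A (w k) = th k *s w k" and i: "i \<le> d"
  shows "coord d w i (A x) = th i * coord d w i x"
proof -
  have "coord d w i (A x) = (\<Sum>k\<le>d. coord d w k x * coord d w i (A (w k)))"
    by (rule coord_linear[OF w A])
  also have "\<dots> = (\<Sum>k\<le>d. if k = i then th i * coord d w i x else 0)"
    using i by (intro sum.cong) (auto simp: eig coord_scale[OF w] coord_basis[OF w])
  also have "\<dots> = th i * coord d w i x" using i by simp
  finally show ?thesis .
qed

text \<open>Each factor \<open>A - th k I\<close> kills the \<open>k\<close>-th eigencoordinate and
  the other factors keep it zero, so \<open>d + 1\<close> factors leave nothing. This closes the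
  split recursion at the last index.\<close>

lemma split_vector_eigenbasis:
  assumes A: "Vector_Spaces.linear scale scale A" and w: "is_basis d w"
    and eig: "\<And>k. k \<le> d \<Longrightarrow> A (w k) = th k *s w k"
  shows "split_vector A th u (Suc d) = 0"
proof -
  interpret A: Vector_Spaces.linear scale scale A by fact
  have "coord d w k (split_vector A th u i) = 0" if "k < i" "k \<le> d" for k i
    using that
  proof (induction i)
    case (Suc i)
    then have "coord d w k (A x) = th k * coord d w k x" for x
      by (simp add: coord_eigenbasis[OF w A eig])
    then show ?case using Suc
      by (cases "k = i") (simp_all add: split_vector_Suc[OF A] coord_diff[OF w] coord_scale[OF w])
  qed simp
  then show ?thesis
    by (intro coord_eqI[OF w]) (simp add: coord_zero[OF w])
qed

text \<open>In the eigenbasis \<open>v\<close> of \<open>As\<close> the split vector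
  \<open>u i\<close> has coordinates only up to index \<open>i\<close>, the leading one nonzero. The
  \<open>i\<close>-th coordinate of \<open>u (i + 1)\<close> is computed twice, from the action of
  \<open>As\<close> and from \<open>A (u i) - th i u i\<close>; equating the results isolates the
  diagonal entry.\<close>

lemma diagonal_entry:
  assumes A: "Vector_Spaces.linear scale scale A" and As: "Vector_Spaces.linear scale scale As"
    and w: "is_basis d w" "\<And>k. k \<le> d \<Longrightarrow> A (w k) = th k *s w k"
    and v: "leonard_basis d A As v" "\<And>k. k \<le> d \<Longrightarrow> As (v k) = ths k *s v k"
    and inj: "inj_on ths {..d}"
    and split: "\<And>i. i \<in> {1..d} \<Longrightarrow> As (split_vector A th (v 0) i) =
      ths i *s split_vector A th (v 0) i + vphi i *s split_vector A th (v 0) (i - 1)"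
    and i: "i \<le> d"
  shows "coord d v i (A (v i)) =
    th i + split_ratio d ths vphi i - split_ratio d ths vphi (Suc i)"
proof -
  let ?u = "split_vector A th (v 0)"
  let ?b = "\<lambda>i j. coord d v i (A (v j))"
  let ?c = "split_ratio d ths vphi"
  have bas: "is_basis d v" using v by (simp add: leonard_basis_def)
  have tri: "?b i j = 0" if "i \<le> d" "j \<le> d" "i > Suc j \<or> j > Suc i" for i j
    using v that by (auto simp: leonard_basis_def irreducible_tridiagonal_def matrix_wrt_def)
  have sub: "?b (Suc i) i \<noteq> 0" if "i < d" for i
    using v that by (auto simp: leonard_basis_def irreducible_tridiagonal_def matrix_wrt_def)
  have uSuc: "?u (Suc i) = A (?u i) - th i *s ?u i" for i by (rule split_vector_Suc[OF A])
  note cs = coord_add[OF bas] coord_diff[OF bas] coord_scale[OF bas]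
  have upper: "coord d v j (?u i) = 0" if "i < j" "j \<le> d" for i j
    using that
  proof (induction i arbitrary: j)
    case 0
    then show ?case by (simp add: split_vector_0 coord_basis[OF bas])
  next
    case (Suc i)
    have "coord d v k (?u i) * ?b j k = 0" if "k \<le> d" for k
      using Suc that tri[of j k] by (cases "i < k") auto
    then have "coord d v j (A (?u i)) = 0"
      by (subst coord_linear[OF bas A], intro sum.neutral ballI) (simp del: mult_eq_0_iff)
    then show ?case using Suc by (simp add: uSuc cs)
  qed
  have lead: "coord d v (Suc i) (?u (Suc i)) = ?b (Suc i) i * coord d v i (?u i)" if "i < d" for i
  proof -
    have "coord d v (Suc i) (A (?u i)) = (\<Sum>k\<le>d. coord d v k (?u i) * ?b (Suc i) k)"
      by (rule coord_linear[OF bas A])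
    also have "\<dots> = (\<Sum>k\<le>d. if k = i then coord d v i (?u i) * ?b (Suc i) i else 0)"
    proof (rule sum.cong)
      fix k assume "k \<in> {..d}"
      then show "coord d v k (?u i) * ?b (Suc i) k =
          (if k = i then coord d v i (?u i) * ?b (Suc i) i else 0)"
        using upper[of i k] tri[of "Suc i" k] that by (cases k i rule: linorder_cases) auto
    qed simp
    finally show ?thesis using that upper[of i "Suc i"] by (simp add: uSuc cs)
  qed
  have lead_nz: "coord d v i (?u i) \<noteq> 0" if "i \<le> d" for i
    using that by (induction i) (simp_all add: lead sub split_vector_0 coord_basis[OF bas])
  have below: "coord d v i (?u (Suc i)) = - ?c (Suc i) * coord d v i (?u i)" if "i < d" for i
  proof -
    have "coord d v i (As (?u (Suc i))) = ths i * coord d v i (?u (Suc i))"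
      using that by (intro coord_eigenbasis[OF bas As v(2)]) auto
    then have "(ths (Suc i) - ths i) * coord d v i (?u (Suc i)) = - vphi (Suc i) * coord d v i (?u i)"
      using split[of "Suc i"] that by (simp add: cs algebra_simps)
    moreover have "ths (Suc i) \<noteq> ths i" using inj that by (auto simp: inj_on_eq_iff)
    ultimately show ?thesis using that by (simp add: split_ratio_def field_simps)
  qed
  have step: "coord d v i (?u (Suc i)) = (?b i i - th i - ?c i) * coord d v i (?u i)" if "i \<le> d" for i
  proof (cases i)
    case 0
    then show ?thesis
      by (simp add: uSuc split_vector_0 cs coord_basis[OF bas] split_ratio_def)
  next
    case (Suc m)
    have "coord d v i (A (?u i)) = (\<Sum>k\<le>d. coord d v k (?u i) * ?b i k)"
      by (rule coord_linear[OF bas A])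
    also have "\<dots> = (\<Sum>k\<le>d. (if k = i then coord d v i (?u i) * ?b i i else 0) +
        (if k = m then coord d v m (?u i) * ?b i m else 0))"
    proof (rule sum.cong)
      fix k assume "k \<in> {..d}"
      then show "coord d v k (?u i) * ?b i k = (if k = i then coord d v i (?u i) * ?b i i else 0) +
        (if k = m then coord d v m (?u i) * ?b i m else 0)"
        using upper[of i k] tri[of i k] that Suc by (cases "k < m"; cases "k = m"; cases "k = i") auto
    qed simp
    also have "\<dots> = coord d v i (?u i) * ?b i i + coord d v m (?u i) * ?b i m"
      using that Suc by (simp add: sum.distrib)
    \<comment> \<open>\<open>below\<close> at \<open>m\<close> replaces the coordinate by
      \<open>- c i\<close> times the leading coefficient of \<open>u m\<close>, and
      \<open>lead\<close> turns that coefficient times the subdiagonal entry into the leading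
      coefficient of \<open>u i\<close>.\<close>
    also have "coord d v m (?u i) * ?b i m = - ?c i * coord d v i (?u i)"
      using below[of m] lead[of m] that Suc by (simp add: mult_ac)
    finally show ?thesis by (simp add: uSuc cs algebra_simps)
  qed
  \<comment> \<open>For \<open>i = d\<close> there is no split relation; instead
    \<open>u (d + 1)\<close> and \<open>c (d + 1)\<close> are both zero.\<close>
  have "coord d v i (?u (Suc i)) = - ?c (Suc i) * coord d v i (?u i)"
  proof (cases "i = d")
    case True
    then show ?thesis using split_vector_eigenbasis[OF A w]
      by (simp add: split_ratio_def coord_zero[OF bas])
  qed (use below[of i] i in auto)
  then have "?b i i - th i - ?c i = - ?c (Suc i)"
    using step[OF i] lead_nz[OF i] by (metis mult_right_cancel)
  then show ?thesis by (simp add: algebra_simps)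
qed

section \<open>The zero diagonal space as a linear dependence\<close>

lemma span_pencil:
  "X \<in> module.span (\<lambda>c X v. c *s X v) {id, As, A, A \<circ> As} \<longleftrightarrow>
     (\<exists>e0 e1 e2 e3. X = (\<lambda>w. e0 *s w + e1 *s As w + e2 *s A w + e3 *s A (As w)))"
proof -
  interpret F: vector_space "\<lambda>c (X :: 'b \<Rightarrow> 'b) v. c *s X v" by (rule vector_space_pointwise)
  have "X \<in> F.span {id, As, A, A \<circ> As} \<longleftrightarrow> (\<exists>e0 e1 e2 e3.
      X - (\<lambda>v. e0 *s id v) - (\<lambda>v. e1 *s As v) - (\<lambda>v. e2 *s A v) - (\<lambda>v. e3 *s (A \<circ> As) v) = 0)"
    by (simp only: F.span_insert F.span_empty mem_Collect_eq singleton_iff)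
  also have "\<dots> \<longleftrightarrow> (\<exists>e0 e1 e2 e3. X = (\<lambda>w. e0 *s w + e1 *s As w + e2 *s A w + e3 *s A (As w)))"
    by (intro ex_cong1) (simp add: fun_eq_iff diff_diff_eq)
  finally show ?thesis .
qed

text \<open>In an eigenbasis of \<open>As\<close> the idempotent \<open>Es i\<close> projects to the
  \<open>i\<close>-th coordinate, so \<open>Es i X Es i = 0\<close> says that the
  \<open>i\<close>-th diagonal entry of \<open>X\<close> is zero. The four generators are linearly
  independent, hence nonzero elements correspond to nonzero coefficient quadruples.\<close>

lemma zero_diagonal_space_nonzero_iff:
  assumes sys: "leonard_system d A E As Es" and arr: "parameter_array d A E As Es th ths vphi phi"
    and d: "d \<ge> 1"
  shows "inj_on ths {..d}"
    and "zero_diagonal_space d A As Es \<noteq> {0} \<longleftrightarrow>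
      diag_dependent d ths (\<lambda>i. th i + split_ratio d ths vphi i - split_ratio d ths vphi (Suc i))"
proof -
  let ?a = "\<lambda>i. th i + split_ratio d ths vphi i - split_ratio d ths vphi (Suc i)"
  have A: "Vector_Spaces.linear scale scale A" and As: "Vector_Spaces.linear scale scale As"
    using sys by (auto simp: leonard_system_def leonard_pair_def)
  have E: "eigenvalue_sequence d A E th" and Es: "eigenvalue_sequence d As Es ths"
    using arr by (auto simp: parameter_array_def)
  obtain th' where th': "standard_ordering d A As th'" "eigenvalue_sequence d A E th'"
    using sys by (auto simp: leonard_system_def standard_idempotents_def)
  obtain ths' where ths': "standard_ordering d As A ths'" "eigenvalue_sequence d As Es ths'"
    using sys by (auto simp: leonard_system_def standard_idempotents_def)
  have eq: "th' i = th i" "ths' i = ths i" if "i \<le> d" for i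
    using that eigenvalue_sequence_unique th' ths' E Es by blast+
  have bij: "bij_betw ths {..d} (eigenvalues As)"
    using ths' bij_betw_cong[of "{..d}" ths' ths] eq by (simp add: standard_ordering_def)
  then show inj: "inj_on ths {..d}" by (simp add: bij_betw_def)
  obtain w where w: "is_basis d w" "\<And>k. k \<le> d \<Longrightarrow> A (w k) = th k *s w k"
    using th' eq by (auto simp: standard_ordering_def leonard_basis_def eigenspace_def)
  obtain v where v: "leonard_basis d A As v" "\<And>k. k \<le> d \<Longrightarrow> As (v k) = ths k *s v k"
    "\<And>k. k \<le> d \<Longrightarrow> v k \<noteq> 0"
    using ths' eq by (auto simp: standard_ordering_def eigenspace_def)
  have bas: "is_basis d v" using v by (simp add: leonard_basis_def)
  have Esl: "Vector_Spaces.linear scale scale (Es i)" if "i \<le> d" for i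
    using Es that by (auto simp: eigenvalue_sequence_def primitive_idempotent_def is_projection_def)
  have Esv: "Es i (v j) = (if i = j then v i else 0)" if "i \<le> d" "j \<le> d" for i j
  proof -
    have P: "is_projection (Es i) (eigenspace As (ths i))
        (span (\<Union>s\<in>eigenvalues As - {ths i}. eigenspace As s))"
      using Es that by (auto simp: eigenvalue_sequence_def primitive_idempotent_def)
    have vj: "v j \<in> eigenspace As (ths j)" using v that by (simp add: eigenspace_def)
    show ?thesis
    proof (cases "i = j")
      case True
      then show ?thesis using P vj by (simp add: is_projection_def)
    next
      case False
      then have "ths j \<noteq> ths i" using inj that by (auto simp: inj_on_eq_iff)
      moreover have "ths j \<in> eigenvalues As" using bij that by (auto simp: bij_betw_def)
      ultimately have "v j \<in> span (\<Union>s\<in>eigenvalues As - {ths i}. eigenspace As s)"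
        using vj by (intro span_base) auto
      then show ?thesis using P False by (simp add: is_projection_def)
    qed
  qed
  have Es_coord: "Es i x = coord d v i x *s v i" if "i \<le> d" for i x
  proof (rule linear_eq_on_basis[OF bas Esl[OF that]])
    show "Vector_Spaces.linear scale scale (\<lambda>x. coord d v i x *s v i)"
      by (simp add: linear_iff coord_add[OF bas] coord_scale[OF bas] scale_left_distrib)
  qed (use that in \<open>simp add: Esv coord_basis[OF bas]\<close>)
  have diag: "coord d v i (A (v i)) = ?a i" if "i \<le> d" for i
  proof (rule diagonal_entry[OF A As w v(1,2) inj _ that])
    fix k assume k: "k \<in> {1..d}"
    \<comment> \<open>\<open>first_split_sequence\<close> binds its own eigenvalue sequences;
      uniqueness transfers its relations to \<open>th\<close> and \<open>ths\<close>.\<close>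
    obtain th2 ths2 where 2: "eigenvalue_sequence d A E th2" "eigenvalue_sequence d As Es ths2"
      and split: "\<forall>u\<in>range (Es 0) - {0}. \<forall>i\<in>{1..d}. As (split_vector A th2 u i) =
              ths2 i *s split_vector A th2 u i + vphi i *s split_vector A th2 u (i - 1)"
      using arr by (auto simp: parameter_array_def first_split_sequence_def)
    have eq2: "th2 i = th i" "ths2 i = ths i" if "i \<le> d" for i
      using that eigenvalue_sequence_unique 2 E Es by blast+
    have S: "split_vector A th2 u i = split_vector A th u i" if "i \<le> d" for u i
      using that eq2 unfolding split_vector_def by (intro foldr_cong) auto
    have "v 0 \<in> range (Es 0) - {0}"
      using Esv[of 0 0] v(3)[of 0] by (auto intro: range_eqI[of _ _ "v 0"])
    then have "As (split_vector A th2 (v 0) k) =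
        ths2 k *s split_vector A th2 (v 0) k + vphi k *s split_vector A th2 (v 0) (k - 1)"
      using split k by blast
    then show "As (split_vector A th (v 0) k) =
        ths k *s split_vector A th (v 0) k + vphi k *s split_vector A th (v 0) (k - 1)"
      using k S[of k] S[of "k - 1"] eq2(2)[of k] by auto
  qed
  define pencil where "pencil = (\<lambda>(e0, e1, e2, e3) w. e0 *s w + e1 *s As w + e2 *s A w + e3 *s A (As w))"
  have pl: "Vector_Spaces.linear scale scale (pencil e)" for e
    using A As by (cases e) (simp add: pencil_def linear_iff algebra_simps)
  have pv: "coord d v i (pencil (e0, e1, e2, e3) (v j)) =
      (if i = j then e0 + e1 * ths j else 0) + (e2 + e3 * ths j) * coord d v i (A (v j))"
    if "i \<le> d" "j \<le> d" for i j e0 e1 e2 e3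
  proof -
    interpret A: Vector_Spaces.linear scale scale A by (rule A)
    show ?thesis using that v(2)[of j]
      by (simp add: pencil_def coord_add[OF bas] coord_scale[OF bas] coord_basis[OF bas] A.scale
          algebra_simps)
  qed
  have comp: "Es i \<circ> X \<circ> Es i = 0 \<longleftrightarrow> coord d v i (X (v i)) = 0"
    if "i \<le> d" "Vector_Spaces.linear scale scale X" for i X
  proof -
    interpret X: Vector_Spaces.linear scale scale X by (rule that)
    show ?thesis
    proof
      assume "Es i \<circ> X \<circ> Es i = 0"
      then have "(Es i \<circ> X \<circ> Es i) (v i) = 0" by simp
      then show "coord d v i (X (v i)) = 0"
        using that v(3)[of i] by (simp add: Esv Es_coord[where x = "X (v i)"])
    qed (use that in \<open>simp add: fun_eq_iff Es_coord X.scale coord_scale[OF bas]\<close>)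
  qed
  \<comment> \<open>The off-diagonal entries at (1,0) and (0,1) isolate
    \<open>e2 + e3 * ths 0\<close> and \<open>e2 + e3 * ths 1\<close>; once these vanish, two
    diagonal entries do the same for \<open>e0\<close> and \<open>e1\<close>. An affine function
    with two distinct zeros is zero.\<close>
  have pz: "pencil e = 0 \<longleftrightarrow> e = (0, 0, 0, 0)" for e
  proof
    assume "pencil e = 0"
    obtain e0 e1 e2 e3 where e: "e = (e0, e1, e2, e3)" by (cases e)
    have z: "coord d v i (pencil e (v j)) = 0" for i j
      using \<open>pencil e = 0\<close> by (simp add: coord_zero[OF bas])
    have "ths 0 \<noteq> ths 1" using inj d by (auto simp: inj_on_eq_iff)
    have
      "coord d v (Suc 0) (A (v 0)) \<noteq> 0" "coord d v 0 (A (v (Suc 0))) \<noteq> 0"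
      using v(1) d by (auto simp: leonard_basis_def irreducible_tridiagonal_def matrix_wrt_def)
    then have "e2 + e3 * ths 0 = 0" "e2 + e3 * ths 1 = 0"
      using z[of 1 0] z[of 0 1] pv[of 1 0] pv[of 0 1] d e by auto
    moreover from this have "e0 + e1 * ths 0 = 0" "e0 + e1 * ths 1 = 0"
      using z[of 0 0] z[of 1 1] pv[of 0 0] pv[of 1 1] d e by auto
    moreover have "x = 0 \<and> y = 0" if "x + y * ths 0 = 0" "x + y * ths 1 = 0" for x y
    proof -
      have "y * (ths 0 - ths 1) = 0" using that by algebra
      then show ?thesis using \<open>ths 0 \<noteq> ths 1\<close> that by simp
    qed
    ultimately show "e = (0, 0, 0, 0)" using e by blast
  qed (simp add: pencil_def fun_eq_iff)
  have Z: "zero_diagonal_space d A As Es = {X. \<exists>e. X = pencil e \<and>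
      (\<forall>i\<le>d. coord d v i (X (v i)) = 0)}"
  proof -
    have "zero_diagonal_space d A As Es = {X. \<exists>e. X = pencil e \<and> (\<forall>i\<le>d. Es i \<circ> X \<circ> Es i = 0)}"
      by (auto simp: zero_diagonal_space_def span_pencil pencil_def)
    then show ?thesis using comp pl by auto
  qed
  have "0 \<in> zero_diagonal_space d A As Es"
    unfolding Z using pz[of "(0, 0, 0, 0)"] by (simp add: coord_zero[OF bas]) metis
  then have "zero_diagonal_space d A As Es \<noteq> {0} \<longleftrightarrow>
      (\<exists>X\<in>zero_diagonal_space d A As Es. X \<noteq> 0)"
    by blast
  also have "\<dots> \<longleftrightarrow> (\<exists>e. pencil e \<noteq> 0 \<and> (\<forall>i\<le>d. coord d v i (pencil e (v i)) = 0))"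
    unfolding Z by blast
  also have "\<dots> \<longleftrightarrow> diag_dependent d ths ?a"
    by (simp add: pz diag_dependent_def pv diag algebra_simps, intro ex_cong1) auto
  finally show "zero_diagonal_space d A As Es \<noteq> {0} \<longleftrightarrow> diag_dependent d ths ?a" .
qed

end

section \<open>Dependence of rational sequences\<close>

lemma diag_dependentI:
  assumes "\<And>i. i \<le> d \<Longrightarrow> e0 + e1 * x i + e2 * a i + e3 * a i * x i = 0"
    and "(e0, e1, e2, e3) \<noteq> (0, 0, 0, 0)"
  shows "diag_dependent d x a"
  unfolding diag_dependent_def using assms by blast

text \<open>The substitution acts on the coefficients by a triangular map with diagonal
  \<open>1, k, l, k * l\<close>, so a nonzero quadruple stays nonzero.\<close>

lemma diag_dependent_affine_imp:
  fixes x a :: "nat \<Rightarrow> 'a::field"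
  assumes dep: "diag_dependent d x' a'" and k: "k \<noteq> 0" "l \<noteq> 0"
    and x: "\<And>i. i \<le> d \<Longrightarrow> x' i = m + k * x i" and a: "\<And>i. i \<le> d \<Longrightarrow> a' i = n + l * a i"
  shows "diag_dependent d x a"
proof -
  obtain e0 e1 e2 e3 where nz: "(e0, e1, e2, e3) \<noteq> (0, 0, 0, 0)"
    and e: "\<And>i. i \<le> d \<Longrightarrow> e0 + e1 * x' i + e2 * a' i + e3 * a' i * x' i = 0"
    using dep unfolding diag_dependent_def by blast
  show ?thesis
  proof (rule diag_dependentI)
    show "(e0 + e1 * m + e2 * n + e3 * n * m) + k * (e1 + e3 * n) * x i + l * (e2 + e3 * m) * a i
        + k * l * e3 * a i * x i = 0" if "i \<le> d" for i
      using e[OF that] by (simp add: x[OF that] a[OF that] algebra_simps)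
    show "(e0 + e1 * m + e2 * n + e3 * n * m, k * (e1 + e3 * n), l * (e2 + e3 * m), k * l * e3)
        \<noteq> (0, 0, 0, 0)"
      using nz k by auto
  qed
qed

lemma diag_dependent_affine:
  fixes x a :: "nat \<Rightarrow> 'a::field"
  assumes k: "k \<noteq> 0" "l \<noteq> 0"
    and x: "\<And>i. i \<le> d \<Longrightarrow> x' i = m + k * x i" and a: "\<And>i. i \<le> d \<Longrightarrow> a' i = n + l * a i"
  shows "diag_dependent d x' a' \<longleftrightarrow> diag_dependent d x a"
proof
  assume "diag_dependent d x a"
  then show "diag_dependent d x' a'"
    by (rule diag_dependent_affine_imp[where m = "- m / k" and k = "1 / k" and n = "- n / l" and l = "1 / l"])
      (use k in \<open>auto simp: x a field_simps\<close>)
qed (rule diag_dependent_affine_imp[OF _ k x a])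

lemma cubic_eq_zero:
  fixes x :: "nat \<Rightarrow> 'a::field"
  assumes "d \<ge> 3" and inj: "inj_on x {..d}"
    and zero: "\<And>i. i \<le> d \<Longrightarrow> c0 + c1 * x i + c2 * x i ^ 2 + c3 * x i ^ 3 = 0"
  shows "c0 = 0 \<and> c1 = 0 \<and> c2 = 0 \<and> c3 = 0"
proof -
  let ?p = "[:c0, c1, c2, c3:]"
  have "?p = 0"
  proof (rule ccontr)
    assume nz: "?p \<noteq> 0"
    have "x ` {..d} \<subseteq> {z. poly ?p z = 0}"
      using zero by (auto simp: power2_eq_square power3_eq_cube algebra_simps)
    then have "card (x ` {..d}) \<le> card {z. poly ?p z = 0}"
      by (intro card_mono poly_roots_finite nz)
    also have "\<dots> \<le> degree ?p" by (rule card_poly_roots_bound[OF nz])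
    also have "\<dots> \<le> 3" by (auto simp: degree_pCons_eq_if)
    finally show False using card_image[OF inj] \<open>d \<ge> 3\<close> by simp
  qed
  then show ?thesis by simp
qed

text \<open>Multiplying by the denominator gives a cubic in \<open>x i\<close> that vanishes
  identically. Its leading coefficient is \<open>e1\<close>; the others say that
  \<open>f (X^2 + b X + c) + (g0 + g1 X) (m X + n)\<close> is the zero polynomial. The rows are kept
  in the conclusion because multiplication by the denominator loses information at a pole.\<close>

lemma rational_diag_dependent:
  fixes x :: "nat \<Rightarrow> 'a::field"
  assumes "d \<ge> 3" and inj: "inj_on x {..d}" and dep: "diag_dependent d x a"
    and a: "\<And>i. i \<le> d \<Longrightarrow> a i * (x i ^ 2 + b * x i + c) = m * x i + n"
  obtains f g0 g1 where "(g0, g1) \<noteq> (0, 0)" "f + g1 * m = 0"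
    "b * f + g0 * m + g1 * n = 0" "c * f + g0 * n = 0"
    "\<And>i. i \<le> d \<Longrightarrow> f + (g0 + g1 * x i) * a i = 0"
proof -
  obtain e0 e1 e2 e3 where nz: "(e0, e1, e2, e3) \<noteq> (0, 0, 0, 0)"
    and e: "\<And>i. i \<le> d \<Longrightarrow> e0 + e1 * x i + e2 * a i + e3 * a i * x i = 0"
    using dep unfolding diag_dependent_def by blast
  have "(c * e0 + e2 * n) + (b * e0 + c * e1 + e2 * m + e3 * n) * x i +
      (e0 + b * e1 + e3 * m) * x i ^ 2 + e1 * x i ^ 3 = 0" if "i \<le> d" for i
    using e[OF that] a[OF that] by algebra
  from cubic_eq_zero[OF assms(1) inj this]
  have c: "c * e0 + e2 * n = 0" "b * e0 + c * e1 + e2 * m + e3 * n = 0" "e0 + b * e1 + e3 * m = 0"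
    "e1 = 0"
    by auto
  show ?thesis
  proof (rule that[of e2 e3 e0])
    show "(e2, e3) \<noteq> (0, 0)" using nz c by auto
    show "e0 + (e2 + e3 * x i) * a i = 0" if "i \<le> d" for i
      using e[OF that] c by (simp add: algebra_simps)
  qed (use c in \<open>auto simp: algebra_simps\<close>)
qed

section \<open>\<open>q\<close>-Racah and \<open>q\<close>-Hahn type\<close>

text \<open>Here \<open>e\<close> and \<open>p\<close> are the sum and product of \<open>r1\<close>
  and \<open>r2\<close>. At \<open>z = 1\<close> and \<open>z = 1 / y\<close>, with
  \<open>z = q ^ i\<close>, the numerator of \<open>c\<close> vanishes, so the end values, which
  come from \<open>c 0 = c (d + 1) = 0\<close>, satisfy the inner relation too. If
  \<open>t z^2 = 1\<close> there, the relation holds but no longer determines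
  \<open>\<rho>\<close>.\<close>

lemma q_ladder_boundary:
  fixes q t p y s e :: "'a::field"
  assumes st: "s * t = p * y" and y: "y * q ^ Suc d = 1"
    and M: "M = t + p + y + s + e * (1 + y)" and K: "K = (1 + y) * (t + p) + e * (t + y)"
    and rho0: "\<rho> 0 = e + y + s" and rhoN: "\<rho> (Suc d) = e + 1 + s * q ^ Suc d"
    and rho: "\<And>i. i \<in> {1..d} \<Longrightarrow> \<rho> i * (1 - t * (q ^ i)\<^sup>2) = q ^ i * (M - K * q ^ i)"
    and i: "i \<le> Suc d"
  shows "\<rho> i * (1 - t * (q ^ i)\<^sup>2) = q ^ i * (M - K * q ^ i)"
proof -
  consider "i = 0" | "i \<in> {1..d}" | "i = Suc d" using i by fastforce
  then show ?thesis
  proof cases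
    case 1
    have "(e + y + s) * (1 - t) = M - K" using st unfolding M K by algebra
    then show ?thesis using 1 rho0 by simp
  next
    case 3
    have "(e + 1 + s * z) * (1 - t * z\<^sup>2) = z * (M - K * z)" if "y * z = 1" for z
      using st that unfolding M K by algebra
    then show ?thesis using 3 rhoN y by simp
  qed (use rho in auto)
qed

text \<open>With \<open>z = q ^ i\<close>, the product
  \<open>(1 - t z^2) (1 - t q^2 z^2) / z^2\<close> of neighbouring denominators equals
  \<open>x^2 - t (1 + q)^2\<close>, a polynomial in \<open>x\<close>.\<close>

lemma q_ladder_difference:
  fixes q t :: "'a::field"
  assumes rho: "\<And>i. i \<le> Suc d \<Longrightarrow> \<rho> i * (1 - t * (q ^ i)\<^sup>2) = q ^ i * (M - K * q ^ i)"
    and q: "q \<noteq> 0" and i: "i \<le> d" and x: "x = 1 / q ^ i + t * q * q ^ i"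
  shows "(\<rho> i - \<rho> (Suc i)) * (x\<^sup>2 + 0 * x + - t * (1 + q)\<^sup>2) = (1 - q) * M * x + - (1 - q) * (1 + q) * K"
proof -
  define z where "z = q ^ i"
  have z: "z \<noteq> 0" and x: "x * z = 1 + t * q * z\<^sup>2"
    using q x by (auto simp: z_def field_simps power2_eq_square)
  have r: "\<rho> i * (1 - t * z\<^sup>2) = z * (M - K * z)"
    "\<rho> (Suc i) * (1 - t * (q * z)\<^sup>2) = q * z * (M - K * (q * z))"
    using rho[of i] rho[of "Suc i"] i by (auto simp: z_def mult.commute)
  have "z\<^sup>2 * ((\<rho> i - \<rho> (Suc i)) * (x\<^sup>2 + 0 * x + - t * (1 + q)\<^sup>2)) =
    z\<^sup>2 * ((1 - q) * M * x + - (1 - q) * (1 + q) * K)"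
    using r x by algebra
  moreover have "z\<^sup>2 \<noteq> 0" using z by simp
  ultimately show ?thesis by (metis mult_left_cancel)
qed

text \<open>\<open>t\<close> times the resultant \<open>t M^2 - K^2\<close> factors as
  \<open>(t - 1) (t - y^2) ((t + p)^2 - t e^2)\<close>, and the last factor is
  \<open>(t - r1^2) (t - r2^2)\<close> for \<open>e = r1 + r2\<close>, \<open>p = r1 r2\<close>. The
  first two factors mark a pole at \<open>x 0\<close> or \<open>x d\<close>; under the negated claim
  rows 0 and \<open>d\<close> exclude them.\<close>

lemma q_ladder_dependent:
  fixes q t p y s e :: "'a::field"
  assumes d: "d \<ge> 3" and q: "q \<noteq> 0" "t \<noteq> 0" and qi: "\<And>i. i \<in> {1..d} \<Longrightarrow> q ^ i \<noteq> 1"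
    and tq: "\<And>i. i \<in> {2..2 * d} \<Longrightarrow> t * q ^ i \<noteq> 1"
    and st: "s * t = p * y" and y: "y * q ^ Suc d = 1"
    and M: "M = t + p + y + s + e * (1 + y)" and K: "K = (1 + y) * (t + p) + e * (t + y)"
    and rho0: "\<rho> 0 = e + y + s" and rhoN: "\<rho> (Suc d) = e + 1 + s * q ^ Suc d"
    and rho': "\<And>i. i \<in> {1..d} \<Longrightarrow> \<rho> i * (1 - t * (q ^ i)\<^sup>2) = q ^ i * (M - K * q ^ i)"
    and inj: "inj_on (\<lambda>i. 1 / q ^ i + t * q * q ^ i) {..d}"
    and dep: "diag_dependent d (\<lambda>i. 1 / q ^ i + t * q * q ^ i) (\<lambda>i. \<rho> i - \<rho> (Suc i))"
  shows "(t + p)\<^sup>2 = t * e\<^sup>2"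
proof (rule ccontr)
  assume contra: "(t + p)\<^sup>2 \<noteq> t * e\<^sup>2"
  note rho = q_ladder_boundary[where \<rho> = \<rho>, OF st y M K rho0 rhoN rho']
  define x where "x = (\<lambda>i. 1 / q ^ i + t * q * q ^ i)"
  have x: "x i = 1 / q ^ i + t * q * q ^ i" for i by (simp add: x_def)
  have diff: "(\<rho> i - \<rho> (Suc i)) * ((x i)\<^sup>2 + 0 * x i + - t * (1 + q)\<^sup>2) =
      (1 - q) * M * x i + - (1 - q) * (1 + q) * K" if "i \<le> d" for i
    by (rule q_ladder_difference[OF rho q(1) that x])
  obtain g0 g1 f where g: "(g0, g1) \<noteq> (0, 0)"
    and e1: "f + g1 * ((1 - q) * M) = 0"
    and e2: "0 * f + g0 * ((1 - q) * M) + g1 * (- (1 - q) * (1 + q) * K) = 0"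
    and e3: "- t * (1 + q)\<^sup>2 * f + g0 * (- (1 - q) * (1 + q) * K) = 0"
    and row: "\<And>i. i \<le> d \<Longrightarrow> f + (g0 + g1 * x i) * (\<rho> i - \<rho> (Suc i)) = 0"
    by (rule rational_diag_dependent[OF d inj[folded x_def] dep[folded x_def] diff])
      (assumption, rule that, assumption+)
  have q1: "1 - q \<noteq> 0" and q2: "1 + q \<noteq> 0" "1 - q\<^sup>2 \<noteq> 0"
    using qi[of 1] qi[of 2] d by (auto simp: power2_eq_square add_eq_0_iff)
  have f: "f = - g1 * (1 - q) * M" using e1 by (simp add: algebra_simps eq_neg_iff_add_eq_0)
  have "(1 - q) * (g0 * M - g1 * (1 + q) * K) = 0" using e2 by algebra
  then have g0M: "g0 * M = g1 * (1 + q) * K" using q1 by simp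
  have "(1 - q) * (1 + q) * (g1 * t * (1 + q) * M - g0 * K) = 0" using e3 f by algebra
  then have g0K: "g0 * K = g1 * t * (1 + q) * M" using q1 q2 by simp
  have "g1 * (1 + q) * (K\<^sup>2 - t * M\<^sup>2) = 0" "g0 * (K\<^sup>2 - t * M\<^sup>2) = 0"
    using g0M g0K by algebra+
  then have res: "K\<^sup>2 = t * M\<^sup>2" using g q2 by auto
  have "(t - 1) * (t - y\<^sup>2) * ((t + p)\<^sup>2 - t * e\<^sup>2) = t * (t * M\<^sup>2 - K\<^sup>2)"
    using st unfolding M K by algebra
  then have cases: "t = 1 \<or> t = y\<^sup>2" using res contra by simp
  have y0: "y \<noteq> 0" using y by auto
  \<comment> \<open>For \<open>t = 1\<close> the relation at \<open>i = 0\<close> reads 0 = 0, so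
    \<open>\<rho> 0\<close> is known only from its closed form; row 0 then yields an independent
    equation.\<close>
  have "t \<noteq> 1"
  proof
    assume t: "t = 1"
    then have y1: "y \<noteq> 1" using y tq[of "Suc d"] d by auto
    have s: "s = p * y" using st t by simp
    have MK: "K = M" and Mf: "M = (1 + y) * (1 + p + e)"
      using s t unfolding M K by algebra+
    have "(1 - q) * (\<rho> 1 * (1 + q) - q * M) = 0"
      using rho[of 1] d t MK by (simp add: algebra_simps power2_eq_square)
    then have r1: "\<rho> 1 * (1 + q) = q * M" using q1 by simp
    have x0: "x 0 = 1 + q" by (simp add: x t)
    have row0: "f + (g0 + g1 * (1 + q)) * (\<rho> 0 - \<rho> 1) = 0"
      using row[of 0] by (simp add: x0)
    show False
    proof (cases "M = 0")
      case False
      have "M * (g0 - g1 * (1 + q)) = 0" using g0M MK by algebra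
      then have g0: "g0 = g1 * (1 + q)" using False by simp
      then have g1: "g1 \<noteq> 0" using g by auto
      have "g1 * (1 + q) * ((y - 1) * (1 + p - e)) = 0"
        using row0 f r1 g0 rho0 s Mf by algebra
      then have "1 + p = e" using g1 q2 y1 by simp
      then show False using contra t by simp
    next
      \<comment> \<open>If \<open>M = 0\<close>, the coefficient equations leave \<open>g0\<close>
        and \<open>g1\<close> free. Then \<open>y = - 1\<close> and
        \<open>\<rho> 1 = \<rho> d = 0\<close>, and rows 0 and \<open>d\<close> make
        \<open>g0 + g1 X\<close> vanish at the distinct points \<open>x 0\<close> and
        \<open>x d\<close>.\<close>
      case True
      have "1 + p + e \<noteq> 0"
      proof
        assume "1 + p + e = 0"
        then have "(t + p)\<^sup>2 = t * e\<^sup>2" using t by algebra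
        then show False using contra by simp
      qed
      then have "1 + y = 0" using Mf True by simp
      then have y: "y = - 1" by (simp add: add_eq_0_iff)
      have f0: "f = 0" using f True by simp
      have "\<rho> 1 = 0" using r1 True q2 by simp
      moreover have "\<rho> 0 \<noteq> 0"
      proof
        assume "\<rho> 0 = 0"
        then have "e = 1 + p" using rho0 y s by (simp add: algebra_simps)
        then show False using contra t by simp
      qed
      ultimately have gx0: "g0 + g1 * x 0 = 0" using row0 f0 x0 by simp
      have "\<rho> d * (1 - (q ^ d)\<^sup>2) = 0" using rho[of d] t MK True by simp
      moreover have "(q ^ d)\<^sup>2 \<noteq> 1" using tq[of "2 * d"] d t by (simp add: power_mult mult.commute)
      ultimately have "\<rho> d = 0" by simp
      moreover have "s * q ^ Suc d = p" using s assms(7) by (simp add: mult.assoc)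
      then have "\<rho> (Suc d) = e + 1 + p" using rhoN by simp
      moreover have "e + 1 + p \<noteq> 0" using \<open>1 + p + e \<noteq> 0\<close> by (simp add: ac_simps)
      moreover have "(g0 + g1 * x d) * (\<rho> d - \<rho> (Suc d)) = 0" using row[of d] f0 by simp
      ultimately have "g0 + g1 * x d = 0" by (metis diff_0 mult_eq_0_iff neg_equal_0_iff_equal)
      then have "g1 * (x 0 - x d) = 0" using gx0 by algebra
      moreover have "x 0 \<noteq> x d"
        using inj_onD[OF inj[folded x_def], of 0 d] d by auto
      ultimately show False using gx0 g by simp
    qed
  qed
  \<comment> \<open>Mirror case: \<open>x d\<close> is the pole and row \<open>d\<close> replaces
    row 0. Since \<open>t \<noteq> 1\<close> excludes \<open>y = - 1\<close>, the subcase
    \<open>M = 0\<close> cannot occur.\<close>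
  then have t: "t = y\<^sup>2" using cases by simp
  have y1: "y \<noteq> 1" "y \<noteq> - 1" using t \<open>t \<noteq> 1\<close> by auto
  have "y * (s * y - p) = 0" using st t by algebra
  then have s: "s * y = p" using y0 by simp
  have MK: "K = y * M" and Mf: "y * M = (1 + y) * (t + p + y * e)"
    unfolding M K t s[symmetric] by (simp_all add: algebra_simps power2_eq_square)
  have "t + p + y * e \<noteq> 0"
  proof
    assume "t + p + y * e = 0"
    then have "(t + p)\<^sup>2 = t * e\<^sup>2" using t by algebra
    then show False using contra by simp
  qed
  then have M0: "M \<noteq> 0" using Mf y1 by (auto simp: add_eq_0_iff)
  have z: "q ^ d * q * y = 1" using y by (simp add: algebra_simps)
  define w where "w = q ^ d"
  have wz: "w * q * y = 1" using z by (simp add: w_def)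
  have "1 / w = q * y" using z q by (simp add: w_def field_simps)
  then have "x d = q * y + y\<^sup>2 * q * w" by (simp add: x t w_def)
  then have xd: "x d = y * (1 + q)" using wz by algebra
  have "\<rho> d * (1 - t * w\<^sup>2) = w * (M - y * M * w)" using rho[of d] MK by (simp add: w_def)
  then have "y * (q - 1) * (\<rho> d * (q + 1) * y - M) = 0"
    using wz t by algebra
  then have rd: "\<rho> d * (q + 1) * y = M" using y0 q1 by simp
  have rN: "y * \<rho> (Suc d) = y * (e + 1) + s"
    using rhoN z by (simp add: algebra_simps)
  have "M * (g0 - g1 * y * (1 + q)) = 0" using g0M MK by algebra
  then have g0: "g0 = g1 * y * (1 + q)" using M0 by simp
  then have g1: "g1 \<noteq> 0" using g by auto
  have "f + (g0 + g1 * x d) * (\<rho> d - \<rho> (Suc d)) =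
      g1 * (2 * (\<rho> d * (q + 1) * y) - 2 * (1 + q) * (y * \<rho> (Suc d)) - (1 - q) * M)"
    unfolding f g0 xd by (simp add: algebra_simps)
  also have "\<dots> = g1 * (1 + q) * (M - 2 * (y * (e + 1) + s))"
    unfolding rd rN by (simp add: algebra_simps)
  finally have "M = 2 * (y * (e + 1) + s)" using row[OF order_refl] g1 q2 by simp
  then have "(y - 1) * (t + p - y * e) = 0" using s Mf t by algebra
  then have "t + p = y * e" using y1 by simp
  then have "(t + p)\<^sup>2 = t * e\<^sup>2" using t by algebra
  with contra show False by contradiction
qed

text \<open>For \<open>t = r^2\<close> one gets \<open>K = r M\<close>, and a factor
  \<open>1 - r z\<close> cancels, leaving \<open>\<rho> i (1 + r z) = z M\<close>. The product of
  neighbouring denominators over \<open>z\<close> is now \<open>x + r (1 + q)\<close>, linear in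
  \<open>x\<close>, which is the dependence.\<close>

lemma q_ladder_dependent_of_square:
  fixes q r r' y s e :: "'a::field"
  assumes q: "q \<noteq> 0" "r \<noteq> 0" and rq: "\<And>i. i \<in> {1..d} \<Longrightarrow> r * q ^ i \<noteq> 1"
    and st: "s * r = r' * y" and y: "y * q ^ Suc d = 1"
    and M: "M = r\<^sup>2 + r * r' + y + s + (r + r') * (1 + y)"
    and rho0: "\<rho> 0 = (r + r') + y + s" and rhoN: "\<rho> (Suc d) = (r + r') + 1 + s * q ^ Suc d"
    and rho: "\<And>i. i \<in> {1..d} \<Longrightarrow> \<rho> i * (1 - r\<^sup>2 * (q ^ i)\<^sup>2) =
      q ^ i * (M - ((1 + y) * (r\<^sup>2 + r * r') + (r + r') * (r\<^sup>2 + y)) * q ^ i)"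
  shows "diag_dependent d (\<lambda>i. 1 / q ^ i + r\<^sup>2 * q * q ^ i) (\<lambda>i. \<rho> i - \<rho> (Suc i))"
proof -
  have "r * M - (r + r') * (1 + r) * (r + y) = s * r - r' * y"
    unfolding M by (simp add: algebra_simps power2_eq_square)
  then have Mf: "r * M = (r + r') * (1 + r) * (r + y)" using st by simp
  have K: "(1 + y) * (r\<^sup>2 + r * r') + (r + r') * (r\<^sup>2 + y) = r * M"
    unfolding Mf by algebra
  have step: "\<rho> i * (1 + r * q ^ i) = q ^ i * M" if "i \<le> Suc d" for i
  proof -
    consider "i = 0" | "i \<in> {1..d}" | "i = Suc d" using \<open>i \<le> Suc d\<close> by fastforce
    \<comment> \<open>At inner indices \<open>1 - r z\<close> is nonzero and may be cancelled; at
      the ends it may be zero, so the reduced relation is checked there from the closed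
      forms.\<close>
    then show ?thesis
    proof cases
      case 1
      have "r * ((r + r' + y + s) * (1 + r) - M) = 0" using st Mf by algebra
      then show ?thesis using 1 rho0 q by simp
    next
      case 2
      have "(1 - r * z) * (w * (1 + r * z) - z * M) = 0"
        if "w * (1 - r\<^sup>2 * z\<^sup>2) = z * (M - r * M * z)" for w z
        using that by algebra
      from this[OF rho[OF 2, unfolded K]] show ?thesis using rq[OF 2] by simp
    next
      case 3
      have "r * ((r + r' + 1 + s * z) * (1 + r * z) - z * M) = 0" if "y * z = 1" for z
        using st Mf that by algebra
      from this[OF y] show ?thesis using 3 rhoN q by simp
    qed
  qed
  show ?thesis
  proof (rule diag_dependentI)
    fix i assume i: "i \<le> d"
    define z where "z = q ^ i"
    have z: "z \<noteq> 0" using q by (simp add: z_def)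
    have "\<rho> i * (1 + r * z) = z * M" "\<rho> (Suc i) * (1 + r * (q * z)) = q * z * M"
      using step[of i] step[of "Suc i"] i by (auto simp: z_def)
    moreover define x where "x = 1 / z + r\<^sup>2 * q * z"
    then have "x * z = 1 + r\<^sup>2 * q * z\<^sup>2" using z by (simp add: field_simps power2_eq_square)
    ultimately have "z * (- ((1 - q) * M) + r * (1 + q) * (\<rho> i - \<rho> (Suc i))
        + (\<rho> i - \<rho> (Suc i)) * x) = 0"
      by algebra
    then have "- ((1 - q) * M) + r * (1 + q) * (\<rho> i - \<rho> (Suc i)) + (\<rho> i - \<rho> (Suc i)) * x = 0"
      using z by simp
    then show "- ((1 - q) * M) + 0 * (1 / q ^ i + r\<^sup>2 * q * q ^ i) + r * (1 + q) * (\<rho> i - \<rho> (Suc i))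
        + 1 * (\<rho> i - \<rho> (Suc i)) * (1 / q ^ i + r\<^sup>2 * q * q ^ i) = 0"
      by (simp add: x_def z_def)
  qed simp
qed

text \<open>
  The parameters \<open>s\<close>, \<open>r1\<close>, \<open>r2\<close> may vanish, so that \<open>q\<close>-Hahn type is the case \<open>s = r2 = 0\<close>. Below,
  \<open>\<rho>\<close> is what remains of \<open>c i\<close> after division by \<open>1 / z - t z\<close> at \<open>z = q ^ i\<close>, up to the factor \<open>h k\<close>.
\<close>

lemma q_array_dependent_iff:
  fixes th ths vphi :: "nat \<Rightarrow> 'a::field"
  assumes d: "d \<ge> 3" and nz: "q \<noteq> 0" "h \<noteq> 0" "hs \<noteq> 0" "t \<noteq> 0"
    and rr: "r1 * r2 = s * t * q ^ (d + 1)"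
    and qi: "\<And>i. i \<in> {1..d} \<Longrightarrow> q ^ i \<noteq> 1 \<and> r1 * q ^ i \<noteq> 1 \<and> r2 * q ^ i \<noteq> 1"
    and tq: "\<And>i. i \<in> {2..2 * d} \<Longrightarrow> t * q ^ i \<noteq> 1"
    and th: "\<And>i. i \<le> d \<Longrightarrow> th i = th 0 + h * (1 - q ^ i) * (1 - s * q ^ (i + 1)) * q powi (- int i)"
    and ths: "\<And>i. i \<le> d \<Longrightarrow> ths i = ths 0 + hs * (1 - q ^ i) * (1 - t * q ^ (i + 1)) * q powi (- int i)"
    and vphi: "\<And>i. i \<in> {1..d} \<Longrightarrow> vphi i = h * hs * q powi (1 - 2 * int i) * (1 - q ^ i) *
        (1 - q powi (int i - int d - 1)) * (1 - r1 * q ^ i) * (1 - r2 * q ^ i)"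
    and inj: "inj_on ths {..d}"
  shows "diag_dependent d ths (\<lambda>i. th i + split_ratio d ths vphi i - split_ratio d ths vphi (Suc i))
    \<longleftrightarrow> t = r1\<^sup>2 \<or> t = r2\<^sup>2"
proof -
  define y where "y = 1 / q ^ Suc d"
  \<comment> \<open>\<open>h * k\<close> is the scalar factor of \<open>c i\<close>:
    \<open>h * hs * q\<close> from \<open>vphi\<close> over \<open>hs * (1 - q)\<close> from the
    eigenvalue difference.\<close>
  define k where "k = q / (1 - q)"
  define x where "x = (\<lambda>i. 1 / q ^ i + t * q * q ^ i)"
  define e where "e = r1 + r2"
  define p where "p = r1 * r2"
  define M where "M = t + p + y + s + e * (1 + y)"
  define K where "K = (1 + y) * (t + p) + e * (t + y)"
  let ?c = "split_ratio d ths vphi"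
  define \<rho> where "\<rho> i = ?c i / (h * k) - 1 / q ^ i + (e + 1 + y) + s * q ^ i" for i
  have y: "y * q ^ Suc d = 1" using nz by (simp add: y_def)
  have st: "s * t = p * y" using rr nz by (simp add: p_def y_def)
  have q1: "1 - q \<noteq> 0" using qi[of 1] d by auto
  have k: "k \<noteq> 0" "k * (1 - q) = q" using nz q1 by (simp_all add: k_def)
  define C where "C = ths 0 - hs * (1 + t * q)"
  have ths': "ths i = C + hs * x i" if "i \<le> d" for i
    using ths[OF that] nz by (simp add: C_def x_def power_int_minus field_simps)
  have inj_x: "inj_on x {..d}"
    using inj by (auto simp: inj_on_def ths')
  have c: "?c i = h * k * (\<rho> i + 1 / q ^ i - (e + 1 + y) - s * q ^ i)" for i
    using nz k by (simp add: \<rho>_def)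
  have a: "th i + ?c i - ?c (Suc i) = (th 0 - h * (1 + s * q)) + h * k * (\<rho> i - \<rho> (Suc i))"
    if "i \<le> d" for i
  proof -
    define z where "z = q ^ i"
    have z: "z \<noteq> 0" using nz by (simp add: z_def)
    have "th i = th 0 - h * (1 + s * q) + h * (1 / z + s * q * z)"
      using th[OF that] nz z by (simp add: z_def power_int_minus field_simps)
    \<comment> \<open>The Laurent part of \<open>c\<close>, differenced, cancels the nonconstant
      part of \<open>th i\<close>; only \<open>\<rho> i - \<rho> (Suc i)\<close> survives.\<close>
    moreover have "1 / z + s * q * z + k * (1 / z - s * z) - k * (1 / (q * z) - s * (q * z)) = 0"
    proof -
      have "1 / z = q * (1 / (q * z))" using nz z by (simp add: field_simps)
      then show ?thesis using k by algebra
    qed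
    ultimately show ?thesis unfolding c by (simp add: z_def[symmetric]) algebra
  qed
  have rho0: "\<rho> 0 = e + y + s" by (simp add: \<rho>_def split_ratio_def)
  have rhoN: "\<rho> (Suc d) = e + 1 + s * q ^ Suc d"
    by (simp add: \<rho>_def split_ratio_def y_def)
  have rho: "\<rho> i * (1 - t * (q ^ i)\<^sup>2) = q ^ i * (M - K * q ^ i)" if i: "i \<in> {1..d}" for i
  proof -
    define z where "z = q ^ i"
    have z: "z \<noteq> 0" using nz by (simp add: z_def)
    obtain j where j: "i = Suc j" using i by (cases i) auto
    have "q ^ j = z / q" using nz by (simp add: z_def j)
    then have "x (i - 1) = q / z + t * z" using nz z by (simp add: x_def j)
    moreover have "x i = 1 / z + t * q * z" by (simp add: x_def z_def)
    ultimately have "x i - x (i - 1) = (1 - q) * (1 - t * z\<^sup>2) / z"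
      using z by (simp add: field_simps power2_eq_square)
    moreover have "ths i - ths (i - 1) = hs * (x i - x (i - 1))"
      using i by (simp add: j ths' right_diff_distrib)
    ultimately have "ths i - ths (i - 1) = hs * (1 - q) * (1 - t * z\<^sup>2) / z"
      by (simp add: mult.assoc)
    moreover have "ths i \<noteq> ths (i - 1)" using inj i by (auto simp: inj_on_eq_iff)
    ultimately have diff: "ths i - ths (i - 1) = hs * (1 - q) * (1 - t * z\<^sup>2) / z" "1 - t * z\<^sup>2 \<noteq> 0"
      by auto
    have "q powi (1 - 2 * int i) = q / z\<^sup>2"
      using nz by (simp add: power_int_diff z_def power_int_mult power2_eq_square power_mult_distrib)
    moreover have "q powi (int i - int d - 1) = z * y"
      using nz by (simp add: power_int_diff z_def y_def)
    ultimately have "vphi i = h * hs * (q / z\<^sup>2) * (1 - z) * (1 - z * y) * (1 - e * z + p * z\<^sup>2)"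
      using vphi[OF i] by (simp add: z_def[symmetric] e_def p_def algebra_simps power2_eq_square)
    then have "?c i = h * k * ((1 - z) * (1 - z * y) * (1 - e * z + p * z\<^sup>2) / (z * (1 - t * z\<^sup>2)))"
      using i diff nz z q1 by (simp add: split_ratio_def k_def power2_eq_square mult_ac)
    then have "h * k * (\<rho> i + 1 / z - (e + 1 + y) - s * z) =
        h * k * ((1 - z) * (1 - z * y) * (1 - e * z + p * z\<^sup>2) / (z * (1 - t * z\<^sup>2)))"
      using c[of i] unfolding z_def by metis
    moreover have "h * k \<noteq> 0" using nz k by simp
    ultimately have "\<rho> i + 1 / z - (e + 1 + y) - s * z =
        (1 - z) * (1 - z * y) * (1 - e * z + p * z\<^sup>2) / (z * (1 - t * z\<^sup>2))"
      by (metis mult_left_cancel)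
    then have "(\<rho> i + 1 / z - (e + 1 + y) - s * z) * (z * (1 - t * z\<^sup>2)) =
        (1 - z) * (1 - z * y) * (1 - e * z + p * z\<^sup>2)"
      using z diff by simp
    moreover have "1 / z * z = 1" using z by simp
    \<comment> \<open>\<open>s t = p y\<close> cancels the terms in \<open>z^4\<close>; what remains
      is \<open>z^2 (M - K z)\<close>.\<close>
    ultimately have "z * (\<rho> i * (1 - t * z\<^sup>2)) = z * (z * (M - K * z))"
      using st unfolding M_def K_def by algebra
    then show ?thesis using z unfolding z_def[symmetric] by simp
  qed
  have "diag_dependent d ths (\<lambda>i. th i + ?c i - ?c (Suc i)) \<longleftrightarrow>
      diag_dependent d x (\<lambda>i. \<rho> i - \<rho> (Suc i))"
    by (rule diag_dependent_affine[OF _ _ ths' a]) (use nz k in auto)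
  also have "\<dots> \<longleftrightarrow> t = r1\<^sup>2 \<or> t = r2\<^sup>2"
  proof
    assume "diag_dependent d x (\<lambda>i. \<rho> i - \<rho> (Suc i))"
    then have "(t + p)\<^sup>2 = t * e\<^sup>2"
      using q_ladder_dependent[OF d nz(1,4) _ tq st y M_def K_def rho0 rhoN rho] qi inj_x
      unfolding x_def by blast
    then have "(t - r1\<^sup>2) * (t - r2\<^sup>2) = 0" unfolding e_def p_def by algebra
    then show "t = r1\<^sup>2 \<or> t = r2\<^sup>2" by simp
  next
    have "diag_dependent d x (\<lambda>i. \<rho> i - \<rho> (Suc i))"
      if r: "t = r\<^sup>2" "e = r + r'" "p = r * r'" "\<And>i. i \<in> {1..d} \<Longrightarrow> r * q ^ i \<noteq> 1" for r r'
    proof -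
      have r0: "r \<noteq> 0" using r nz by auto
      have "r * (s * r - r' * y) = 0" using st r(1-3) by algebra
      then have sr: "s * r = r' * y" using r0 by simp
      show ?thesis unfolding x_def \<open>t = r\<^sup>2\<close>
        by (rule q_ladder_dependent_of_square[OF nz(1) r0 r(4) sr y refl])
          (use rho0 rhoN rho r in \<open>simp_all add: M_def K_def\<close>)
    qed
    from this[of r1 r2] this[of r2 r1]
    show "t = r1\<^sup>2 \<or> t = r2\<^sup>2 \<Longrightarrow> diag_dependent d x (\<lambda>i. \<rho> i - \<rho> (Suc i))"
      using qi by (auto simp: e_def p_def add.commute mult.commute)
  qed
  finally show ?thesis .
qed

section \<open>Racah type\<close>

text \<open>
  Below, \<open>C\<close> and \<open>\<nu>\<close> are quotient and remainder of the numerator of \<open>16 c i / h\<close> by \<open>w i = 2 i + t\<close>, as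
  polynomials in \<open>w i\<close>; the factor 16 avoids halves.
\<close>

lemma racah_array_dependent_iff:
  fixes th ths vphi :: "nat \<Rightarrow> 'a::field"
  assumes d: "d \<ge> 3" and nz: "h \<noteq> 0" "hs \<noteq> 0" and two: "(2::'a) \<noteq> 0"
    and rr: "r1 + r2 = s + t + of_nat d + 1"
    and tn: "\<And>i. i \<in> {2..2 * d} \<Longrightarrow> t \<noteq> - of_nat i"
    and th: "\<And>i. i \<le> d \<Longrightarrow> th i = th 0 + h * of_nat i * (of_nat i + 1 + s)"
    and ths: "\<And>i. i \<le> d \<Longrightarrow> ths i = ths 0 + hs * of_nat i * (of_nat i + 1 + t)"
    and vphi: "\<And>i. i \<in> {1..d} \<Longrightarrow> vphi i =
      h * hs * of_nat i * (of_nat i - of_nat d - 1) * (of_nat i + r1) * (of_nat i + r2)"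
    and inj: "inj_on ths {..d}"
  shows "diag_dependent d ths (\<lambda>i. th i + split_ratio d ths vphi i - split_ratio d ths vphi (Suc i))
    \<longleftrightarrow> t = 2 * r1 \<or> t = 2 * r2"
proof -
  let ?c = "split_ratio d ths vphi"
  define n :: 'a where "n = of_nat (Suc d)"
  define w :: "nat \<Rightarrow> 'a" where "w i = 2 * of_nat i + t" for i
  define x :: "nat \<Rightarrow> 'a" where "x i = of_nat i * (of_nat i + 1 + t)" for i
  define C where "C u = u ^ 3 + 2 * (s - t) * u\<^sup>2 +
    (t * (t + 2 * n) + (- 2 * t - 2 * n) * (2 * r1 + 2 * r2 - 2 * t) + (2 * r1 - t) * (2 * r2 - t)) * u +
    t * (t + 2 * n) * (2 * r1 + 2 * r2 - 2 * t) + (- 2 * t - 2 * n) * (2 * r1 - t) * (2 * r2 - t)" for u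
  define \<nu> where "\<nu> = t * (t + 2 * n) * (t - 2 * r1) * (t - 2 * r2)"
  define \<rho> where "\<rho> i = 16 * ?c i / h - C (w i)" for i
  have rr: "r1 + r2 = s + t + n" using rr by (simp add: n_def algebra_simps)
  have "(16::'a) = 2 * 2 * 2 * 2" "(32::'a) = 2 * 2 * 2 * 2 * 2" "(8::'a) = 2 * 2 * 2" "(4::'a) = 2 * 2"
    by simp_all
  then have numz: "(16::'a) \<noteq> 0" "(32::'a) \<noteq> 0" "(8::'a) \<noteq> 0" "(4::'a) \<noteq> 0"
    using two by (metis mult_eq_0_iff)+
  \<comment> \<open>For \<open>u = w i\<close> the right side is
    \<open>16 i (i - n) (i + r1) (i + r2)\<close>, the numerator of \<open>16 c i / h\<close> over
    \<open>w i\<close>.\<close>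
  have Cw: "u * C u + \<nu> = (u - t) * (u - t - 2 * n) * (u - t + 2 * r1) * (u - t + 2 * r2)" for u
    using rr unfolding C_def \<nu>_def by algebra
  have wnz: "w i \<noteq> 0" if "i \<in> {1..d}" for i
    using tn[of "2 * i"] that by (simp add: w_def eq_neg_iff_add_eq_0 add.commute)
  have ths': "ths i = ths 0 + hs * x i" if "i \<le> d" for i
    using ths[OF that] by (simp add: x_def mult.assoc)
  have inj_x: "inj_on x {..d}"
    using inj by (intro inj_onI) (metis inj_onD ths' atMost_iff)
  have wx: "w i * w (Suc i) = 4 * x i + t * (t + 2)" for i
    by (simp add: w_def x_def algebra_simps)
  have a: "th i + ?c i - ?c (Suc i) =
      (th 0 + h / 16 * (C t - C (t + 2))) + h / 16 * (\<rho> i - \<rho> (Suc i) - 8 * x i)" if "i \<le> d" for i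
  proof -
    \<comment> \<open>Differencing lowers the cubic \<open>C\<close> to degree two; adding the
      contribution of \<open>th i\<close> leaves a constant minus \<open>8 x i\<close>, so the
      polynomial part of the diagonal is affine in \<open>x i\<close>.\<close>
    have "C (2 * u + t) - C (2 * u + t + 2) + 16 * (u * (u + 1 + s)) =
        C t - C (t + 2) - 8 * (u * (u + 1 + t))" for u
      unfolding C_def by algebra
    from this[of "of_nat i"]
    have "C (w i) - C (w (Suc i)) = C t - C (t + 2) - 8 * x i - 16 * (of_nat i * (of_nat i + 1 + s))"
      by (simp add: w_def x_def algebra_simps)
    moreover define D where "D = (?c i - ?c (Suc i)) / h"
    then have "\<rho> i - \<rho> (Suc i) = 16 * D - (C (w i) - C (w (Suc i)))"
      by (simp add: \<rho>_def diff_divide_distrib right_diff_distrib)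
    ultimately have "\<rho> i - \<rho> (Suc i) - 8 * x i + (C t - C (t + 2)) =
        16 * (D + of_nat i * (of_nat i + 1 + s))"
      by algebra
    then have "h / 16 * (\<rho> i - \<rho> (Suc i) - 8 * x i + (C t - C (t + 2))) =
        h * D + h * of_nat i * (of_nat i + 1 + s)"
      using numz by (simp add: field_simps)
    moreover have "h * D = ?c i - ?c (Suc i)" using nz by (simp add: D_def)
    ultimately have "h / 16 * (\<rho> i - \<rho> (Suc i) - 8 * x i + (C t - C (t + 2))) =
        ?c i - ?c (Suc i) + h * of_nat i * (of_nat i + 1 + s)"
      by simp
    moreover define H where "H = h / 16"
    ultimately show ?thesis using th[OF that] unfolding H_def[symmetric] by algebra
  qed
  have rho0: "\<rho> 0 = - C t" and rhoN: "\<rho> (Suc d) = - C (2 * n + t)"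
    by (simp_all add: \<rho>_def split_ratio_def w_def n_def)
  have rho: "\<rho> i * w i = \<nu>" if i: "i \<in> {1..d}" for i
  proof -
    obtain j where j: "i = Suc j" using i by (cases i) auto
    have "ths i - ths (i - 1) = hs * w i"
      using i ths'[of i] ths'[of j] by (simp add: j x_def w_def algebra_simps)
    moreover have "vphi i = hs * (h * (of_nat i * (of_nat i - n) * (of_nat i + r1) * (of_nat i + r2)))"
    proof -
      have "of_nat i - of_nat d - 1 = of_nat i - n" by (simp add: n_def)
      then show ?thesis using vphi[OF i] by (simp only: mult_ac)
    qed
    ultimately have "?c i * w i = h * (of_nat i * (of_nat i - n) * (of_nat i + r1) * (of_nat i + r2))"
      using i nz wnz[OF i] by (simp add: split_ratio_def)
    moreover have "16 * ?c i / h * w i = 16 * (?c i * w i) / h" by simp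
    ultimately have "16 * ?c i / h * w i = 16 * (of_nat i * (of_nat i - n) * (of_nat i + r1) * (of_nat i + r2))"
      using nz by simp
    also have "\<dots> = w i * C (w i) + \<nu>"
      unfolding Cw by (simp add: w_def algebra_simps)
    finally show ?thesis by (simp add: \<rho>_def algebra_simps)
  qed
  have all: "\<rho> i * w i = \<nu>" if "i \<le> Suc d" for i
  proof -
    consider "i = 0" | "i \<in> {1..d}" | "i = Suc d" using \<open>i \<le> Suc d\<close> by fastforce
    then show ?thesis
    proof cases
      case 1
      then show ?thesis using Cw[of t] rho0 by (simp add: w_def algebra_simps add_eq_0_iff)
    next
      case 3
      have "w i = 2 * n + t" using 3 by (simp add: w_def n_def)
      then show ?thesis using Cw[of "2 * n + t"] rhoN 3 by (simp add: algebra_simps add_eq_0_iff)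
    qed (use rho in auto)
  qed
  have "diag_dependent d ths (\<lambda>i. th i + ?c i - ?c (Suc i)) \<longleftrightarrow>
      diag_dependent d x (\<lambda>i. \<rho> i - \<rho> (Suc i) - 8 * x i)"
    by (rule diag_dependent_affine[OF _ _ ths' a]) (use nz numz in auto)
  also have "\<dots> \<longleftrightarrow> t = 2 * r1 \<or> t = 2 * r2"
  proof
    assume "diag_dependent d x (\<lambda>i. \<rho> i - \<rho> (Suc i) - 8 * x i)"
    then obtain e0 e1 e2 e3 where e: "(e0, e1, e2, e3) \<noteq> (0, 0, 0, 0)"
      and row: "\<And>i. i \<le> d \<Longrightarrow> e0 + e1 * x i + e2 * (\<rho> i - \<rho> (Suc i) - 8 * x i) +
        e3 * (\<rho> i - \<rho> (Suc i) - 8 * x i) * x i = 0"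
      unfolding diag_dependent_def by blast
    define T where "T = t * (t + 2)"
    \<comment> \<open>The row is multiplied by \<open>4 x i + T = w i * w (Suc i)\<close>, which
      turns \<open>\<rho> i - \<rho> (Suc i)\<close> into \<open>2 \<nu>\<close>.\<close>
    have "(T * e0 + 2 * \<nu> * e2) + (4 * e0 + T * e1 - 8 * T * e2 + 2 * \<nu> * e3) * x i +
        (4 * e1 - 32 * e2 - 8 * T * e3) * x i ^ 2 + (- 32 * e3) * x i ^ 3 = 0" if "i \<le> d" for i
    proof -
      have "w (Suc i) = w i + 2" by (simp add: w_def)
      then have "(\<rho> i - \<rho> (Suc i)) * (4 * x i + T) = 2 * \<nu>"
        using all[of i] all[of "Suc i"] that wx[of i] unfolding T_def by simp algebra
      then show ?thesis using row[OF that] by algebra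
    qed
    from cubic_eq_zero[OF d inj_x this]
    have "T * e0 + 2 * \<nu> * e2 = 0" "4 * e0 + T * e1 - 8 * T * e2 + 2 * \<nu> * e3 = 0"
      "4 * e1 - 32 * e2 - 8 * T * e3 = 0" "- 32 * e3 = 0"
      by auto
    then have e3: "e3 = 0" and "4 * (e1 - 8 * e2) = 0" and "4 * e0 + T * (e1 - 8 * e2) = 0"
      and nu: "T * e0 + 2 * \<nu> * e2 = 0"
      using numz by (auto simp: algebra_simps)
    then have "e1 - 8 * e2 = 0" using numz by (metis mult_eq_0_iff)
    then have e1: "e1 = 8 * e2" and e0: "e0 = 0"
      using \<open>4 * e0 + T * (e1 - 8 * e2) = 0\<close> numz by auto
    have e2: "e2 \<noteq> 0" using e e0 e1 e3 by auto
    have "\<nu> = 0" using nu e0 e2 two by simp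
    have eq: "\<rho> i = \<rho> (Suc i)" if "i \<le> d" for i
      using row[OF that] e0 e1 e2 e3 by (simp add: algebra_simps)
    have "\<rho> i = 0" if "i \<in> {1..d}" for i
      using rho[OF that] wnz[OF that] \<open>\<nu> = 0\<close> by simp
    \<comment> \<open>The extra factors \<open>t\<close> and \<open>t + 2 n\<close> of
      \<open>\<nu>\<close> are \<open>w 0\<close> and \<open>w (Suc d)\<close>. Where one is zero,
      \<open>\<nu> = 0\<close> does not force the end value of \<open>\<rho>\<close>, but the end
      row equates it with its neighbour 0.\<close>
    then have 0: "C t = 0" "C (2 * n + t) = 0"
      using eq[of 0] eq[of d] d rho0 rhoN by auto
    have n0: "n \<noteq> 0" if "t = 0"
      using tn[of "Suc d"] d that by (auto simp: n_def simp del: of_nat_Suc)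
    from \<open>\<nu> = 0\<close> consider "t = 0" | "t + 2 * n = 0" | "t = 2 * r1 \<or> t = 2 * r2"
      unfolding \<nu>_def by auto
    then show "t = 2 * r1 \<or> t = 2 * r2"
    proof cases
      case 1
      then have "8 * n * (r1 * r2) = 0" using 0(1) unfolding C_def by algebra
      then show ?thesis using 1 numz n0 by auto
    next
      case 2
      then have t: "t = - 2 * n" by algebra
      have "C (2 * n + t) = 8 * n * ((r1 + n) * (r2 + n))"
        unfolding C_def t by (simp add: algebra_simps)
      then have "8 * n * ((r1 + n) * (r2 + n)) = 0" using 0(2) by simp
      moreover have "n \<noteq> 0" using n0 t by auto
      ultimately show ?thesis using t numz by (auto simp: add_eq_0_iff)
    qed
  next
    assume t: "t = 2 * r1 \<or> t = 2 * r2"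
    then have "\<nu> = 0" unfolding \<nu>_def by auto
    have "C t = 0" "C (2 * n + t) = 0"
      using t rr unfolding C_def by (elim disjE; algebra)+
    have "\<rho> i = 0" if "i \<le> Suc d" for i
    proof -
      consider "i = 0" | "i \<in> {1..d}" | "i = Suc d" using \<open>i \<le> Suc d\<close> by fastforce
      then show ?thesis
        by cases (use rho wnz \<open>\<nu> = 0\<close> rho0 rhoN \<open>C t = 0\<close> \<open>C (2 * n + t) = 0\<close> in auto)
    qed
    then show "diag_dependent d x (\<lambda>i. \<rho> i - \<rho> (Suc i) - 8 * x i)"
      by (intro diag_dependentI[where ?e0.0 = 0 and ?e1.0 = 8 and ?e2.0 = 1 and ?e3.0 = 0]) auto
  qed
  finally show ?thesis .
qed

lemma two_neq_zero_of_char: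
  assumes "CHAR('a::semiring_1) = 0 \<or> CHAR('a) > 2"
  shows "(2::'a) \<noteq> 0"
proof
  assume "(2::'a) = 0"
  then have "CHAR('a) dvd 2" using of_nat_eq_0_iff_char_dvd[where 'a = 'a, of 2] by simp
  then have "CHAR('a) \<le> 2" "CHAR('a) \<noteq> 0" by (simp add: dvd_imp_le, intro notI) simp
  then show False using assms by simp
qed

section \<open>Bannai/Ito type\<close>

text \<open>Common frame for both parities of \<open>d\<close>: \<open>x\<close> and
  \<open>\<delta>\<close> are \<open>ths\<close> and the diagonal up to affine changes, and
  \<open>\<rho> i\<close> is a fraction over \<open>w i\<close> with numerator alternating between
  \<open>A\<close> and \<open>B\<close>. The relation includes the ends 0 and \<open>Suc d\<close>,
  where \<open>w\<close> may be zero.\<close>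

locale bannai_ito_ladder =
  fixes d :: nat and w \<rho> x \<delta> :: "nat \<Rightarrow> 'a::field" and A B :: 'a
  assumes two: "(2::'a) \<noteq> 0"
    and rho: "i \<le> Suc d \<Longrightarrow> \<rho> i * w i = (if even i then A else B)"
    and x: "x i = (if even i then w i else - w (Suc i))"
    and w_Suc: "w (Suc i) = w i + 2"
    and \<delta>: "\<delta> i = (if even i then - (\<rho> i + \<rho> (Suc i)) else \<rho> i + \<rho> (Suc i))"
begin

text \<open>In terms of \<open>x\<close> the parity disappears: always
  \<open>x i * (x i + 2) = w i * w (Suc i)\<close>, and away from the poles
  \<open>\<delta> i = - A / x i - B / (x i + 2)\<close>.\<close>

lemma quotient:
  assumes "i \<le> d"
  shows "\<delta> i * ((x i)\<^sup>2 + 2 * x i + 0) = - (A + B) * x i + - 2 * A"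
proof (cases "even i")
  case True
  then have "\<delta> i = - (\<rho> i + \<rho> (Suc i))" "x i = w i" "\<rho> i * w i = A" "\<rho> (Suc i) * (w i + 2) = B"
    using rho[of i] rho[of "Suc i"] assms by (simp_all add: x \<delta> w_Suc)
  then show ?thesis by algebra
next
  case False
  then have "\<delta> i = \<rho> i + \<rho> (Suc i)" "x i = - w i - 2" "\<rho> i * w i = B" "\<rho> (Suc i) * (w i + 2) = A"
    using rho[of i] rho[of "Suc i"] assms by (simp_all add: x \<delta> w_Suc)
  then show ?thesis by algebra
qed

text \<open>Only the pole at 0 is left, so \<open>\<delta> i * x i = - A\<close>. The hypothesis
  concerns \<open>\<rho>\<close> because \<open>B = 0\<close> would not settle an end index where
  \<open>w\<close> vanishes.\<close>

lemma dependent_of_odd_zero: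
  assumes "\<And>i. i \<le> Suc d \<Longrightarrow> odd i \<Longrightarrow> \<rho> i = 0"
  shows "diag_dependent d x \<delta>"
proof (rule diag_dependentI)
  show "A + 0 * x i + 0 * \<delta> i + 1 * \<delta> i * x i = 0" if "i \<le> d" for i
    using rho[of i] rho[of "Suc i"] assms[of i] assms[of "Suc i"] that
    by (cases "even i") (simp_all add: x \<delta>)
qed simp

text \<open>Only the pole at \<open>- 2\<close> is left, so
  \<open>\<delta> i * (x i + 2) = - B\<close>.\<close>

lemma dependent_of_even_zero:
  assumes "\<And>i. i \<le> Suc d \<Longrightarrow> even i \<Longrightarrow> \<rho> i = 0"
  shows "diag_dependent d x \<delta>"
proof (rule diag_dependentI)
  show "B + 0 * x i + 2 * \<delta> i + 1 * \<delta> i * x i = 0" if i: "i \<le> d" for i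
  proof (cases "even i")
    case True
    then have "\<delta> i = - \<rho> (Suc i)" "x i = w (Suc i) - 2" "\<rho> (Suc i) * w (Suc i) = B"
      using rho[of "Suc i"] assms[of i] i by (simp_all add: x \<delta> w_Suc)
    then show ?thesis by algebra
  next
    case False
    then have "\<delta> i = \<rho> i" "x i + 2 = - w i" "\<rho> i * w i = B"
      using rho[of i] assms[of "Suc i"] i by (simp_all add: x \<delta> w_Suc)
    then have "B + \<delta> i * (x i + 2) = 0" by simp
    then show ?thesis by (simp add: algebra_simps)
  qed
qed simp

text \<open>The factor \<open>g0 + g1 X\<close> must vanish at each pole with nonzero residue: at 0
  if \<open>A \<noteq> 0\<close>, at \<open>- 2\<close> if \<open>B \<noteq> 0\<close>.\<close>

lemma dependentE:
  assumes "d \<ge> 3" "inj_on x {..d}" "diag_dependent d x \<delta>"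
  obtains g0 g1 where "(g0, g1) \<noteq> (0, 0)" "g0 * A = 0" "(2 * g1 - g0) * B = 0"
    "\<And>i. i \<le> d \<Longrightarrow> g1 * (A + B) + (g0 + g1 * x i) * \<delta> i = 0"
proof (rule rational_diag_dependent[OF assms quotient], assumption)
  fix f g0 g1
  assume g: "(g0, g1) \<noteq> (0, 0)" "f + g1 * - (A + B) = 0"
    "2 * f + g0 * - (A + B) + g1 * (- 2 * A) = 0" "0 * f + g0 * (- 2 * A) = 0"
    and row: "\<And>i. i \<le> d \<Longrightarrow> f + (g0 + g1 * x i) * \<delta> i = 0"
  have f: "f = g1 * (A + B)" using g(2) by algebra
  show thesis
  proof (rule that)
    show A: "g0 * A = 0" using g(4) two by (simp add: algebra_simps)
    show "(2 * g1 - g0) * B = 0" using g(3) f A by algebra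
  qed (use g row f in auto)
qed

text \<open>For \<open>w 0 = 0\<close> the point \<open>x 0\<close> is the pole 0 and
  \<open>g0 * A = 0\<close> says nothing. Row 0, with \<open>\<rho> 1\<close> known from
  \<open>B\<close>, restores the condition with \<open>\<rho> 0\<close> in place of
  \<open>A\<close>.\<close>

lemma row_0:
  assumes row: "g1 * (A + B) + (g0 + g1 * x 0) * \<delta> 0 = 0" and w: "w 0 = 0" and A: "A = 0"
    and g: "(2 * g1 - g0) * B = 0"
  shows "g0 * \<rho> 0 = 0"
proof -
  have "2 * \<rho> 1 = B" using rho[of 1] w_Suc[of 0] w by (simp add: mult.commute)
  moreover have "g1 * B - g0 * (\<rho> 0 + \<rho> 1) = 0" using row w A by (simp add: x \<delta> algebra_simps)
  moreover have "2 * (g0 * \<rho> 0) =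
      (2 * g1 - g0) * B - 2 * (g1 * B - g0 * (\<rho> 0 + \<rho> 1)) - g0 * (2 * \<rho> 1 - B)"
    by (simp add: algebra_simps)
  ultimately have "2 * (g0 * \<rho> 0) = 0" using g by simp
  then show ?thesis using two by simp
qed

text \<open>For even \<open>d\<close> the index \<open>Suc d\<close> is odd, so
  \<open>w (Suc d) = 0\<close> puts \<open>x d\<close> at the pole \<open>- 2\<close>; the lost
  condition on \<open>B\<close> returns with \<open>\<rho> (Suc d)\<close> in its place.\<close>

lemma row_last_even:
  assumes row: "g1 * (A + B) + (g0 + g1 * x d) * \<delta> d = 0" and w: "w (Suc d) = 0" and B: "B = 0"
    and d: "even d" and g: "g0 * A = 0"
  shows "(g0 - 2 * g1) * \<rho> (Suc d) = 0"
proof -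
  have wd: "w d = - 2" using w w_Suc[of d] by (simp add: eq_neg_iff_add_eq_0)
  then have "- 2 * \<rho> d = A" using rho[of d] d by (simp add: mult.commute)
  moreover have "g1 * A - (g0 - 2 * g1) * (\<rho> d + \<rho> (Suc d)) = 0"
    using row wd B d by (simp add: x \<delta> algebra_simps)
  moreover have "2 * ((g0 - 2 * g1) * \<rho> (Suc d)) =
      g0 * A - 2 * (g1 * A - (g0 - 2 * g1) * (\<rho> d + \<rho> (Suc d))) + (g0 - 2 * g1) * (- 2 * \<rho> d - A)"
    by (simp add: algebra_simps)
  ultimately have "2 * ((g0 - 2 * g1) * \<rho> (Suc d)) = 0" using g by (simp only:) simp
  then show ?thesis using two by (metis mult_eq_0_iff)
qed

text \<open>For odd \<open>d\<close> the index \<open>Suc d\<close> is even, and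
  \<open>w (Suc d) = 0\<close> puts \<open>x d\<close> at the pole 0, as in
  \<open>row_0\<close>.\<close>

lemma row_last_odd:
  assumes row: "g1 * (A + B) + (g0 + g1 * x d) * \<delta> d = 0" and w: "w (Suc d) = 0" and A: "A = 0"
    and d: "odd d" and g: "(2 * g1 - g0) * B = 0"
  shows "g0 * \<rho> (Suc d) = 0"
proof -
  have "w d = - 2" using w w_Suc[of d] by (simp add: eq_neg_iff_add_eq_0)
  then have "- 2 * \<rho> d = B" using rho[of d] d by (simp add: mult.commute)
  moreover have "g1 * B + g0 * (\<rho> d + \<rho> (Suc d)) = 0"
    using row w A d by (simp add: x \<delta>)
  moreover have "2 * (g0 * \<rho> (Suc d)) =
      2 * (g1 * B + g0 * (\<rho> d + \<rho> (Suc d))) - (2 * g1 - g0) * B + g0 * (- 2 * \<rho> d - B)"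
    by (simp add: algebra_simps)
  ultimately have "2 * (g0 * \<rho> (Suc d)) = 0" using g by (simp only:) simp
  then show ?thesis using two by simp
qed

end

text \<open>
  This covers both parities of \<open>d\<close>. With \<open>w i = 2 i - t\<close>, twice \<open>vphi i / (ths i - ths (i - 1))\<close> is
  \<open>- h (w i + t) (w i + a2) / w i\<close> for even \<open>i\<close> and \<open>h (w i + b1) (w i + b2) / w i\<close> for odd \<open>i\<close>; \<open>\<rho> i\<close> is the
  part with numerator \<open>t a2\<close> or \<open>b1 b2\<close>.
\<close>

lemma bannai_ito_ladder_exists:
  fixes th ths vphi :: "nat \<Rightarrow> 'a::field"
  assumes nz: "h \<noteq> 0" "hs \<noteq> 0" and two: "(2::'a) \<noteq> 0"
    and ti: "\<And>i. i \<in> {1..d} \<Longrightarrow> t \<noteq> 2 * of_nat i"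
    and th: "\<And>i. i \<le> d \<Longrightarrow> th i = th 0 + h * (s - 1 + (1 - s + 2 * of_nat i) * (- 1) ^ i)"
    and ths: "\<And>i. i \<le> d \<Longrightarrow> ths i = ths 0 + hs * (t - 1 + (1 - t + 2 * of_nat i) * (- 1) ^ i)"
    and even: "\<And>i. i \<in> {1..d} \<Longrightarrow> even i \<Longrightarrow>
      vphi i = - h * hs * (2 * of_nat i - t + t) * (2 * of_nat i - t + a2)"
    and odd: "\<And>i. i \<in> {1..d} \<Longrightarrow> odd i \<Longrightarrow>
      vphi i = - h * hs * (2 * of_nat i - t + b1) * (2 * of_nat i - t + b2)"
    and sum: "t + a2 + b1 + b2 = 2 * t - 2 * s"
    and last: "if odd d then a2 = t - 2 * of_nat (Suc d) else b1 = t - 2 * of_nat (Suc d)"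
    and inj: "inj_on ths {..d}"
  obtains w \<rho> x \<delta> where "bannai_ito_ladder d w \<rho> x \<delta> (t * a2) (b1 * b2)"
    "\<And>i. w i = 2 * of_nat i - t" "\<And>i. i \<in> {1..d} \<Longrightarrow> w i \<noteq> 0"
    "\<rho> 0 = - a2" "\<rho> (Suc d) = (if odd d then - t else - b2)" "inj_on x {..d}"
    "diag_dependent d ths (\<lambda>i. th i + split_ratio d ths vphi i - split_ratio d ths vphi (Suc i))
      \<longleftrightarrow> diag_dependent d x \<delta>"
proof -
  let ?c = "split_ratio d ths vphi"
  define w :: "nat \<Rightarrow> 'a" where "w i = 2 * of_nat i - t" for i
  define \<rho> where "\<rho> i = (if even i then - (2 * ?c i / h) - w i - t - a2
    else 2 * ?c i / h - w i - b1 - b2)" for i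
  define x where "x i = (if even i then w i else - w (Suc i))" for i
  define \<delta> where "\<delta> i = (if even i then - (\<rho> i + \<rho> (Suc i)) else \<rho> i + \<rho> (Suc i))" for i
  define C where "C = ths 0 + hs * t"
  have w_Suc: "w (Suc i) = w i + 2" for i by (simp add: w_def)
  have wnz: "w i \<noteq> 0" if "i \<in> {1..d}" for i using ti[OF that] by (simp add: w_def)
  have ths': "ths i = C + hs * x i" if "i \<le> d" for i
    using ths[OF that] by (cases "even i") (simp_all add: C_def x_def w_def algebra_simps)
  have inj_x: "inj_on x {..d}"
    using inj by (auto simp: inj_on_def ths')
  have c: "2 * ?c i = (if even i then - h * (\<rho> i + w i + t + a2) else h * (\<rho> i + w i + b1 + b2))" for i
    using nz by (simp add: \<rho>_def)
  have a: "th i + ?c i - ?c (Suc i) = (th 0 + h * (s - 1)) + h / 2 * \<delta> i" if "i \<le> d" for i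
  proof -
    \<comment> \<open>The terms in \<open>w i\<close> cancel, and \<open>sum\<close> makes the
      constants agree for the two parities.\<close>
    have "2 * (th i + ?c i - ?c (Suc i)) = 2 * (th 0 + h * (s - 1)) + h * \<delta> i"
    proof (cases "even i")
      case True
      have "th i = th 0 + h * (w i + t)" using th[OF that] True by (simp add: w_def)
      moreover have "2 * ?c i = - h * (\<rho> i + w i + t + a2)"
        "2 * ?c (Suc i) = h * (\<rho> (Suc i) + (w i + 2) + b1 + b2)" "\<delta> i = - (\<rho> i + \<rho> (Suc i))"
        using True by (simp_all only: c w_Suc \<delta>_def even_Suc not_True_eq_False simp_thms if_True if_False)
      ultimately show ?thesis using sum by algebra
    next
      case False
      have "th i = th 0 + h * (2 * s - 2 - w i - t)" using th[OF that] False
        by (simp add: w_def algebra_simps)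
      moreover have "2 * ?c i = h * (\<rho> i + w i + b1 + b2)"
        "2 * ?c (Suc i) = - h * (\<rho> (Suc i) + (w i + 2) + t + a2)" "\<delta> i = \<rho> i + \<rho> (Suc i)"
        using False by (simp_all only: c w_Suc \<delta>_def even_Suc not_False_eq_True simp_thms if_True if_False)
      ultimately show ?thesis using sum by algebra
    qed
    then show ?thesis using two by (simp add: field_simps)
  qed
  have rho: "\<rho> i * w i = (if even i then t * a2 else b1 * b2)" if i: "i \<in> {1..d}" for i
  proof -
    obtain j where j: "i = Suc j" using i by (cases i) auto
    have "ths i - ths (i - 1) = hs * (x i - x (i - 1))"
      using i by (simp add: j ths' right_diff_distrib)
    also have "x i - x (i - 1) = (if even i then 2 * w i else - 2 * w i)"
      by (simp add: j x_def w_Suc)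
    finally have diff: "ths i - ths (i - 1) = hs * (if even i then 2 * w i else - 2 * w i)" .
    show ?thesis
    proof (cases "even i")
      case True
      have "?c i = (hs * (- h * ((w i + t) * (w i + a2)))) / (hs * (2 * w i))"
        using even[OF i True] diff True i by (simp add: split_ratio_def w_def mult_ac)
      then have "2 * ?c i * w i = - h * ((w i + t) * (w i + a2))"
        using nz two wnz[OF i] by simp
      then have "h * ((\<rho> i + w i + t + a2) * w i - (w i + t) * (w i + a2)) = 0"
        using True unfolding c by (simp add: algebra_simps)
      then show ?thesis using nz True by (simp add: algebra_simps)
    next
      case False
      have "?c i = (hs * (- h * ((w i + b1) * (w i + b2)))) / (hs * (- 2 * w i))"
        using odd[OF i False] diff False i by (simp add: split_ratio_def w_def mult_ac)
      then have "2 * ?c i * w i = h * ((w i + b1) * (w i + b2))"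
        using nz two wnz[OF i] by simp
      then have "h * ((\<rho> i + w i + b1 + b2) * w i - (w i + b1) * (w i + b2)) = 0"
        using False unfolding c by (simp add: algebra_simps)
      then show ?thesis using nz False by (simp add: algebra_simps)
    qed
  qed
  have rho0: "\<rho> 0 = - a2" by (simp add: \<rho>_def split_ratio_def w_def)
  \<comment> \<open>\<open>last\<close> encodes the factor \<open>i - d - 1\<close> of
    \<open>vphi\<close> in the parity class of \<open>d + 1\<close>; with
    \<open>c (d + 1) = 0\<close> it extends the relation to the last index.\<close>
  have rhoN: "\<rho> (Suc d) = (if odd d then - t else - b2)"
    using last by (auto simp: \<rho>_def split_ratio_def w_def split: if_splits)
  have "bannai_ito_ladder d w \<rho> x \<delta> (t * a2) (b1 * b2)"
  proof
    fix i assume "i \<le> Suc d"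
    then consider "i = 0" | "i \<in> {1..d}" | "i = Suc d" by fastforce
    then show "\<rho> i * w i = (if even i then t * a2 else b1 * b2)"
    proof cases
      case 1
      then show ?thesis using rho0 by (simp add: w_def mult.commute)
    next
      case 3
      then show ?thesis using rhoN last
        by (auto simp: w_def algebra_simps simp del: of_nat_Suc split: if_splits)
    qed (use rho in auto)
  qed (use two in \<open>auto simp: x_def w_Suc \<delta>_def\<close>)
  moreover have "diag_dependent d ths (\<lambda>i. th i + ?c i - ?c (Suc i)) \<longleftrightarrow> diag_dependent d x \<delta>"
    by (rule diag_dependent_affine[OF _ _ ths' a]) (use nz two in auto)
  ultimately show thesis using that w_def wnz rho0 rhoN inj_x by blast
qed

text \<open>The residues are \<open>A = t (t + 2 r1)\<close>,
  \<open>B = (t - 2 n) (t + 2 r2)\<close> for even \<open>d\<close>, and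
  \<open>A = t (t - 2 n)\<close>, \<open>B = (t + 2 r1) (t + 2 r2)\<close> for odd \<open>d\<close>.
  A dependence needs a vanishing residue; the zeros of \<open>t\<close> and \<open>t - 2 n\<close>
  mean \<open>w 0 = 0\<close> and \<open>w (Suc d) = 0\<close>, and the end rows show that they do
  not suffice.\<close>

lemma bannai_ito_array_dependent_iff:
  fixes th ths vphi :: "nat \<Rightarrow> 'a::field"
  assumes d: "d \<ge> 3" and arr: "bannai_ito_array d th ths vphi phi h hs s t r1 r2"
    and inj: "inj_on ths {..d}"
  shows "diag_dependent d ths (\<lambda>i. th i + split_ratio d ths vphi i - split_ratio d ths vphi (Suc i))
    \<longleftrightarrow> t = - 2 * r1 \<or> t = - 2 * r2"
proof -
  define n :: 'a where "n = of_nat (Suc d)"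
  have nz: "h \<noteq> 0" "hs \<noteq> 0" and rr: "r1 + r2 = - s - t + n"
    and char: "CHAR('a) = 0 \<or> prime CHAR('a) \<and> odd CHAR('a)"
    and ti: "\<And>i. i \<in> {1..d} \<Longrightarrow> t \<noteq> 2 * of_nat i"
    and th: "\<And>i. i \<le> d \<Longrightarrow> th i = th 0 + h * (s - 1 + (1 - s + 2 * of_nat i) * (- 1) ^ i)"
    and ths: "\<And>i. i \<le> d \<Longrightarrow> ths i = ths 0 + hs * (t - 1 + (1 - t + 2 * of_nat i) * (- 1) ^ i)"
    using arr unfolding bannai_ito_array_def n_def by (auto simp: algebra_simps)
  have two: "(2::'a) \<noteq> 0"
    by (rule two_neq_zero_of_char) (use char prime_ge_2_nat[of "CHAR('a)"] in \<open>auto simp: le_less\<close>)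
  show ?thesis
  proof (cases "even d")
    case True
    have even: "vphi i = - h * hs * (2 * of_nat i - t + t) * (2 * of_nat i - t + (t + 2 * r1))"
      if "i \<in> {1..d}" "even i" for i
      using arr True that unfolding bannai_ito_array_def by (simp add: algebra_simps)
    have odd: "vphi i = - h * hs * (2 * of_nat i - t + (t - 2 * n)) * (2 * of_nat i - t + (t + 2 * r2))"
      if "i \<in> {1..d}" "odd i" for i
      using arr True that unfolding bannai_ito_array_def n_def by (simp add: algebra_simps)
    have sum: "t + (t + 2 * r1) + (t - 2 * n) + (t + 2 * r2) = 2 * t - 2 * s" using rr by algebra
    obtain w \<rho> x \<delta> where ladder: "bannai_ito_ladder d w \<rho> x \<delta> (t * (t + 2 * r1)) ((t - 2 * n) * (t + 2 * r2))"
      and w: "\<And>i. w i = 2 * of_nat i - t" and wnz: "\<And>i. i \<in> {1..d} \<Longrightarrow> w i \<noteq> 0"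
      and rho0: "\<rho> 0 = - (t + 2 * r1)" and rhoN: "\<rho> (Suc d) = (if odd d then - t else - (t + 2 * r2))"
      and inj_x: "inj_on x {..d}"
      and iff: "diag_dependent d ths (\<lambda>i. th i + split_ratio d ths vphi i - split_ratio d ths vphi (Suc i))
        \<longleftrightarrow> diag_dependent d x \<delta>"
      by (rule bannai_ito_ladder_exists[OF nz two ti th ths even odd sum _ inj])
        (assumption+, use True in \<open>simp add: n_def\<close>, rule that, assumption+)
    interpret bannai_ito_ladder d w \<rho> x \<delta> "t * (t + 2 * r1)" "(t - 2 * n) * (t + 2 * r2)"
      by (rule ladder)
    have "diag_dependent d x \<delta> \<longleftrightarrow> t + 2 * r1 = 0 \<or> t + 2 * r2 = 0"
    proof (rule iffI, rule ccontr)
      assume "diag_dependent d x \<delta>" and r: "\<not> (t + 2 * r1 = 0 \<or> t + 2 * r2 = 0)"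
      then obtain g0 g1 where g: "(g0, g1) \<noteq> (0, 0)" "g0 * (t * (t + 2 * r1)) = 0"
        "(2 * g1 - g0) * ((t - 2 * n) * (t + 2 * r2)) = 0"
        and row: "\<And>i. i \<le> d \<Longrightarrow> g1 * (t * (t + 2 * r1) + (t - 2 * n) * (t + 2 * r2)) +
          (g0 + g1 * x i) * \<delta> i = 0"
        using dependentE[OF d inj_x] by blast
      \<comment> \<open>For \<open>t \<noteq> 0\<close> this is the residue condition; for
        \<open>t = 0\<close> it is row 0, since \<open>\<rho> 0 = - (t + 2 r1)\<close> is
        nonzero.\<close>
      have "g0 = 0"
      proof (cases "t = 0")
        case True
        then have "g0 * \<rho> 0 = 0" using row_0[OF row[of 0]] g(3) w[of 0] by simp
        then show ?thesis using rho0 r by (metis mult_eq_0_iff neg_equal_0_iff_equal)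
      qed (use g r in auto)
      moreover have "g0 - 2 * g1 = 0"
      proof (cases "t - 2 * n = 0")
        case True
        then have "w (Suc d) = 0" using w[of "Suc d"] by (simp add: n_def)
        then have "(g0 - 2 * g1) * \<rho> (Suc d) = 0"
          using row_last_even[OF row[of d]] g(2) True \<open>even d\<close> by simp
        then show ?thesis using rhoN r \<open>even d\<close> by (metis mult_eq_0_iff neg_equal_0_iff_equal)
      qed (use g r in auto)
      ultimately show False using g two by simp
    next
      assume "t + 2 * r1 = 0 \<or> t + 2 * r2 = 0"
      then show "diag_dependent d x \<delta>"
      proof
        assume 0: "t + 2 * r1 = 0"
        show ?thesis
        proof (rule dependent_of_even_zero)
          fix i assume "i \<le> Suc d" "even i"
          then consider "i = 0" | "i \<in> {1..d}" using True by (cases "i = Suc d") fastforce+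
          then show "\<rho> i = 0"
            by cases (use rho[of i] wnz[of i] rho0 0 \<open>even i\<close> in auto)
        qed
      next
        assume 0: "t + 2 * r2 = 0"
        show ?thesis
        proof (rule dependent_of_odd_zero)
          fix i assume "i \<le> Suc d" "odd i"
          then consider "i = Suc d" | "i \<in> {1..d}" by (cases i) fastforce+
          then show "\<rho> i = 0"
            by cases (use rho[of i] wnz[of i] rhoN 0 \<open>odd i\<close> True in auto)
        qed
      qed
    qed
    then show ?thesis using iff by (simp add: eq_neg_iff_add_eq_0)
  next
    case False
    have even: "vphi i = - h * hs * (2 * of_nat i - t + t) * (2 * of_nat i - t + (t - 2 * n))"
      if "i \<in> {1..d}" "even i" for i
      using arr False that unfolding bannai_ito_array_def n_def by (simp add: algebra_simps)
    have odd: "vphi i = - h * hs * (2 * of_nat i - t + (t + 2 * r1)) * (2 * of_nat i - t + (t + 2 * r2))"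
      if "i \<in> {1..d}" "odd i" for i
      using arr False that unfolding bannai_ito_array_def by (simp add: algebra_simps)
    have sum: "t + (t - 2 * n) + (t + 2 * r1) + (t + 2 * r2) = 2 * t - 2 * s" using rr by algebra
    obtain w \<rho> x \<delta> where ladder: "bannai_ito_ladder d w \<rho> x \<delta> (t * (t - 2 * n)) ((t + 2 * r1) * (t + 2 * r2))"
      and w: "\<And>i. w i = 2 * of_nat i - t" and wnz: "\<And>i. i \<in> {1..d} \<Longrightarrow> w i \<noteq> 0"
      and rho0: "\<rho> 0 = - (t - 2 * n)" and rhoN: "\<rho> (Suc d) = (if odd d then - t else - (t + 2 * r2))"
      and inj_x: "inj_on x {..d}"
      and iff: "diag_dependent d ths (\<lambda>i. th i + split_ratio d ths vphi i - split_ratio d ths vphi (Suc i))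
        \<longleftrightarrow> diag_dependent d x \<delta>"
      by (rule bannai_ito_ladder_exists[OF nz two ti th ths even odd sum _ inj])
        (assumption+, use False in \<open>simp add: n_def\<close>, rule that, assumption+)
    interpret bannai_ito_ladder d w \<rho> x \<delta> "t * (t - 2 * n)" "(t + 2 * r1) * (t + 2 * r2)"
      by (rule ladder)
    \<comment> \<open>If \<open>n = 0\<close>, the odd characteristic divides the even number
      \<open>d + 1\<close>, hence is at most \<open>d\<close>; then \<open>t = 0\<close> is twice
      the characteristic, which \<open>ti\<close> forbids.\<close>
    have "n \<noteq> 0" if "t = 0"
    proof
      assume "n = 0"
      then have dvd: "CHAR('a) dvd Suc d" unfolding n_def by (simp only: of_nat_eq_0_iff_char_dvd)
      then have "CHAR('a) \<noteq> 0" by (intro notI) simp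
      moreover have "CHAR('a) \<noteq> Suc d" using char False by auto
      ultimately have "CHAR('a) \<in> {1..d}" using dvd_imp_le[OF dvd] by auto
      from ti[OF this] show False using that by simp
    qed
    then have tn: "t \<noteq> 0 \<or> t - 2 * n \<noteq> 0" using two by auto
    have "diag_dependent d x \<delta> \<longleftrightarrow> (t + 2 * r1) * (t + 2 * r2) = 0"
    proof (rule iffI, rule ccontr)
      assume "diag_dependent d x \<delta>" and r: "(t + 2 * r1) * (t + 2 * r2) \<noteq> 0"
      then obtain g0 g1 where g: "(g0, g1) \<noteq> (0, 0)" "g0 * (t * (t - 2 * n)) = 0"
        "(2 * g1 - g0) * ((t + 2 * r1) * (t + 2 * r2)) = 0"
        and row: "\<And>i. i \<le> d \<Longrightarrow> g1 * (t * (t - 2 * n) + (t + 2 * r1) * (t + 2 * r2)) +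
          (g0 + g1 * x i) * \<delta> i = 0"
        using dependentE[OF d inj_x] by blast
      have "2 * g1 - g0 = 0" using g(3) r by (metis mult_eq_0_iff)
      moreover have "g0 = 0"
      proof -
        consider "t = 0" | "t - 2 * n = 0" | "t * (t - 2 * n) \<noteq> 0" by auto
        then show ?thesis
        proof cases
          case 1
          then have "g0 * \<rho> 0 = 0" using row_0[OF row[of 0]] g(3) w[of 0] by simp
          then show ?thesis using rho0 tn 1 by (metis mult_eq_0_iff neg_equal_0_iff_equal)
        next
          case 2
          then have "w (Suc d) = 0" using w[of "Suc d"] by (simp add: n_def)
          then have "g0 * \<rho> (Suc d) = 0"
            using row_last_odd[OF row[of d]] g(3) 2 False by simp
          then show ?thesis using rhoN tn 2 False by (metis mult_eq_0_iff neg_equal_0_iff_equal)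
        qed (use g in auto)
      qed
      ultimately show False using g two by simp
    next
      assume 0: "(t + 2 * r1) * (t + 2 * r2) = 0"
      show "diag_dependent d x \<delta>"
      proof (rule dependent_of_odd_zero)
        fix i assume "i \<le> Suc d" "odd i"
        \<comment> \<open>Both end indices are even here, so \<open>w\<close> is nonzero at every
          odd index.\<close>
        then have "i \<in> {1..d}" using False by (cases "i = Suc d"; cases i) auto
        then show "\<rho> i = 0" using rho[of i] wnz[of i] 0 \<open>odd i\<close> by auto
      qed
    qed
    then show ?thesis using iff by (simp add: eq_neg_iff_add_eq_0)
  qed
qed

theorem theorem9p3:
  fixes scale :: "'a::alg_closed_field \<Rightarrow> 'b::ab_group_add \<Rightarrow> 'b"
    and d :: nat
    and A As :: "'b \<Rightarrow> 'b"
    and E Es :: "nat \<Rightarrow> 'b \<Rightarrow> 'b"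
  assumes "vector_space scale"
    and "vector_space.dim scale UNIV = d + 1"
    and "d \<ge> 3"
    and "leonard_theory.leonard_system scale d A E As Es"
  shows "(\<forall>q h hs s ss r1 r2.
            leonard_theory.q_racah_type scale d A E As Es q h hs s ss r1 r2 \<longrightarrow>
            (leonard_theory.zero_diagonal_space scale d A As Es \<noteq> {0} \<longleftrightarrow>
               ss = r1 ^ 2 \<or> ss = r2 ^ 2)) \<and>
         (\<forall>q h hs ss r.
            leonard_theory.q_hahn_type scale d A E As Es q h hs ss r \<longrightarrow>
            (leonard_theory.zero_diagonal_space scale d A As Es \<noteq> {0} \<longleftrightarrow>
               ss = r ^ 2)) \<and>
         (\<forall>h hs s ss r1 r2.
            leonard_theory.racah_type scale d A E As Es h hs s ss r1 r2 \<longrightarrow>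
            (leonard_theory.zero_diagonal_space scale d A As Es \<noteq> {0} \<longleftrightarrow>
               ss = 2 * r1 \<or> ss = 2 * r2)) \<and>
         (\<forall>h hs s ss r1 r2.
            leonard_theory.bannai_ito_type scale d A E As Es h hs s ss r1 r2 \<longrightarrow>
            (leonard_theory.zero_diagonal_space scale d A As Es \<noteq> {0} \<longleftrightarrow>
               ss = - 2 * r1 \<or> ss = - 2 * r2))"
proof -
  interpret leonard_theory scale using assms(1) by (simp add: leonard_theory_def)
  note d = assms(3)
  have inj: "inj_on ths {..d}"
    and iff: "zero_diagonal_space d A As Es \<noteq> {0} \<longleftrightarrow>
      diag_dependent d ths (\<lambda>i. th i + split_ratio d ths vphi i - split_ratio d ths vphi (Suc i))"
    if "parameter_array d A E As Es th ths vphi phi" for th ths vphi phi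
    using zero_diagonal_space_nonzero_iff[OF assms(4) that] d by simp_all
  show ?thesis
  proof (intro conjI allI impI)
    fix q h hs s ss r1 r2
    assume "q_racah_type d A E As Es q h hs s ss r1 r2"
    then obtain th ths vphi phi where arr: "parameter_array d A E As Es th ths vphi phi"
      and q: "q_racah_array d th ths vphi phi q h hs s ss r1 r2"
      by (auto simp: q_racah_type_def)
    show "zero_diagonal_space d A As Es \<noteq> {0} \<longleftrightarrow> ss = r1 ^ 2 \<or> ss = r2 ^ 2"
      unfolding iff[OF arr]
      by (rule q_array_dependent_iff[of d q h hs ss r1 r2 s])
        (use q[unfolded q_racah_array_def] d inj[OF arr] in blast)+
  next
    fix q h hs ss r
    assume "q_hahn_type d A E As Es q h hs ss r"
    then obtain th ths vphi phi where arr: "parameter_array d A E As Es th ths vphi phi"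
      and q: "q_hahn_array d th ths vphi phi q h hs ss r"
      by (auto simp: q_hahn_type_def)
    note q = q[unfolded q_hahn_array_def]
    \<comment> \<open>Setting \<open>s = r2 = 0\<close> produces the alternative
      \<open>ss = 0 ^ 2\<close>, which \<open>ss \<noteq> 0\<close> removes afterwards.\<close>
    have "diag_dependent d ths (\<lambda>i. th i + split_ratio d ths vphi i - split_ratio d ths vphi (Suc i))
        \<longleftrightarrow> ss = r ^ 2 \<or> ss = 0 ^ 2"
    proof (rule q_array_dependent_iff[of d q h hs ss r 0 0])
      show "th i = th 0 + h * (1 - q ^ i) * (1 - 0 * q ^ (i + 1)) * q powi (- int i)" if "i \<le> d" for i
        unfolding mult_zero_left diff_zero mult_1_right using q that by blast
      show "q ^ i \<noteq> 1 \<and> r * q ^ i \<noteq> 1 \<and> 0 * q ^ i \<noteq> 1" if "i \<in> {1..d}" for i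
        using q that by simp
      show "vphi i = h * hs * q powi (1 - 2 * int i) * (1 - q ^ i) *
          (1 - q powi (int i - int d - 1)) * (1 - r * q ^ i) * (1 - 0 * q ^ i)" if "i \<in> {1..d}" for i
        unfolding mult_zero_left diff_zero mult_1_right using q that by blast
      show "r * 0 = 0 * ss * q ^ (d + 1)" by simp
    qed (use q d inj[OF arr] in blast)+
    moreover have "ss \<noteq> 0" using q by blast
    ultimately show "zero_diagonal_space d A As Es \<noteq> {0} \<longleftrightarrow> ss = r ^ 2"
      using iff[OF arr] by simp
  next
    fix h hs s ss r1 r2
    assume "racah_type d A E As Es h hs s ss r1 r2"
    then obtain th ths vphi phi where arr: "parameter_array d A E As Es th ths vphi phi"
      and q: "racah_array d th ths vphi phi h hs s ss r1 r2"
      by (auto simp: racah_type_def)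
    have "(2::'a) \<noteq> 0"
      by (rule two_neq_zero_of_char) (use q d in \<open>auto simp: racah_array_def\<close>)
    then show "zero_diagonal_space d A As Es \<noteq> {0} \<longleftrightarrow> ss = 2 * r1 \<or> ss = 2 * r2"
      unfolding iff[OF arr]
      by (rule racah_array_dependent_iff[of d h hs r1 r2 s ss, rotated 3])
        (use q[unfolded racah_array_def] d inj[OF arr] in blast)+
  next
    fix h hs s ss r1 r2
    assume "bannai_ito_type d A E As Es h hs s ss r1 r2"
    then obtain th ths vphi phi where arr: "parameter_array d A E As Es th ths vphi phi"
      and q: "bannai_ito_array d th ths vphi phi h hs s ss r1 r2"
      by (auto simp: bannai_ito_type_def)
    show "zero_diagonal_space d A As Es \<noteq> {0} \<longleftrightarrow> ss = - 2 * r1 \<or> ss = - 2 * r2"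
      unfolding iff[OF arr] by (rule bannai_ito_array_dependent_iff[OF d q inj[OF arr]])
  qed
qed

end
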